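(* Let $G=A\ast_C B$ be a free product of finitely presented groups $A$ and $B$ amalgamated over a finitely generated subgroup $C$. Assume that the following algorithmic problems are decidable: - the Membership Search Problem for the subgroup $C$ in $A$ and in $B$; - the Coset Representative Search Problem for the subgroup $C$ in $A$ and in $B$; - the Cardinality Search Problem for $\Phi(\mathrm{Sub}(C),A)$ in $A$ and for $\Phi(\mathrm{Sub}(C),B)$ in $B$; - the Membership Problem for $N^*_A(C)$ and $Z_A(C)$ in $A$, and for $N^*_B(C)$ and $Z_B(C)$ in $B$. Then there exists an algorithm to determine whether a given element of $G$ is regular or not.
   Context: $A=\langle X\mid R_A\rangle$ and $B=\langle Y\mid R_B\rangle$ are finite presentations; $C$ is generated by a finite set $Z$ and embedded in $A$ and in $B$ by monomorphisms $\phi,\psi$; $G=\langle X\cup Y\mid R_A,R_B,\ z^\phi=z^\psi\ (z\in Z)\rangle$. $A,B$ are identified with subgroups of $G$ and $C=A\cap B$. Elements are given as words in the generators, $C$ by the finite tuples of words $z^\phi$, $z^\psi$. Conjugation: $h^g=g^{-1}hg$, $K^g=g^{-1}Kg$. For $H\in\{A,B,G\}$: $N^*_H(C)=\{g\in H\mid C\cap C^g\neq1\}$ and $Z_H(C)=\bigcup_{g\in N^*_H(C)\smallsetminus C}\left(C^{g^{-1}}\cap C\right)$. The black hole is $BH=(N^*_G(C)\smallsetminus C)\cup Z_G(C)$. Elements of $BH$ are singular; elements of $G\smallsetminus BH$ are regular. Algorithmic problems for $H=A$ or $B$. Membership Search Problem for $C$: given a word $w$, decide whether $w\in C$ and, if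 so, write $w$ as a product of the given generators of $C$. Coset Representative Search Problem for $C$: there are a recursive set of representatives of the right cosets of $C$ in $H$ and an algorithm which for a given word $w$ finds the representative of $Cw$. Membership Problem for a subset: decide whether a given word represents an element of the subset. Cardinality Search Problem. $\mathrm{Sub}(C)$ is the set of all subgroups of $C$. For a collection $\mathcal M$ of subgroups of $H$, $\Phi(\mathcal M,H)$ is the least collection of subsets of $H$ containing $\mathcal M$ and closed under shifts $M\mapsto uMv$ ($u,v\in H$) and under (pairwise) intersections. The Cardinality Search Problem for $\Phi(\mathrm{Sub}(C),H)$: given a set $D\in\Phi(\mathrm{Sub}(C),H)$, decide whether $D$ is empty, finite, or infinite, and if $D$ is finite and non-empty, list all elements of $D$. Sets are given by effective descriptions: $D$ is given by a formal expression built from described subgroups of $C$ by shifts by words of $H$ and intersections; a subgroup of $C$ is described either by a finite generating tuple, or, recursively, as $Dh^{-1}$, where $D\subseteq C$ is a non-empty set in $\Phi(\mathrm{Sub}(C),A)$ or $\Phi(\mathrm{Sub}(C),B)$ given by such an expression and $h\in D$. *)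

theory Defs
  imports "HOL-Algebra.Generated_Groups" "HOL-Library.Nat_Bijection"
begin

section \<open>Algorithms\<close>

text \<open>Partial recursive functions, in the one-argument form in which tuples are coded by
  \<^const>\<open>prod_encode\<close>; \<open>None\<close> is divergence.\<close>

inductive partrec :: "(nat \<Rightarrow> nat option) \<Rightarrow> bool" where
  zero: "partrec (\<lambda>n. Some 0)"
| succ: "partrec (\<lambda>n. Some (Suc n))"
| left: "partrec (\<lambda>n. Some (fst (prod_decode n)))"
| right: "partrec (\<lambda>n. Some (snd (prod_decode n)))"
| pair: "partrec f \<Longrightarrow> partrec g \<Longrightarrow>
    partrec (\<lambda>n. Option.bind (f n) (\<lambda>a. Option.bind (g n) (\<lambda>b. Some (prod_encode (a, b)))))"
| comp: "partrec f \<Longrightarrow> partrec g \<Longrightarrow> partrec (\<lambda>n. Option.bind (g n) f)"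
| prec: "partrec f \<Longrightarrow> partrec g \<Longrightarrow>
    partrec (\<lambda>p. rec_nat (f (fst (prod_decode p)))
      (\<lambda>m r. Option.bind r (\<lambda>i. g (prod_encode (fst (prod_decode p), prod_encode (m, i)))))
      (snd (prod_decode p)))"
| mu: "partrec f \<Longrightarrow>
    partrec (\<lambda>a. if \<exists>n. f (prod_encode (a, n)) = Some 0 \<and>
                      (\<forall>m<n. \<exists>k. f (prod_encode (a, m)) = Some (Suc k))
      then Some (LEAST n. f (prod_encode (a, n)) = Some 0) else None)"

text \<open>\<open>algorithm ei eo I P\<close>: some algorithm, given any input \<open>x \<in> I\<close>, halts with an output
  \<open>y\<close> satisfying \<open>P x y\<close>; \<open>ei\<close> and \<open>eo\<close> code inputs and outputs as numbers. Nothing is required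
  of the algorithm outside \<open>I\<close>.\<close>

definition algorithm ::
    "('a \<Rightarrow> nat) \<Rightarrow> ('b \<Rightarrow> nat) \<Rightarrow> 'a set \<Rightarrow> ('a \<Rightarrow> 'b \<Rightarrow> bool) \<Rightarrow> bool" where
  "algorithm ei eo I P \<longleftrightarrow>
     (\<exists>f. partrec f \<and> (\<forall>x\<in>I. \<exists>y. P x y \<and> f (ei x) = Some (eo y)))"

definition enc_bool :: "bool \<Rightarrow> nat" where
  "enc_bool b = (if b then 1 else 0)"

definition enc_option :: "('a \<Rightarrow> nat) \<Rightarrow> 'a option \<Rightarrow> nat" where
  "enc_option e x = (case x of None \<Rightarrow> 0 | Some y \<Rightarrow> Suc (e y))"

lemma enc_bool_inj: "inj enc_bool"
  by (auto simp: inj_def enc_bool_def split: if_splits)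

lemma enc_option_inj: "inj e \<Longrightarrow> inj (enc_option e)"
  by (auto simp: inj_def enc_option_def split: option.splits)


section \<open>Words and presentations\<close>

text \<open>The letter \<open>(x, True)\<close> is the generator \<open>x\<close>, the letter \<open>(x, False)\<close> is its inverse.\<close>

type_synonym 'g gword = "('g \<times> bool) list"

definition words :: "'g set \<Rightarrow> 'g gword set" where
  "words X = lists (X \<times> UNIV)"

definition winv :: "'g gword \<Rightarrow> 'g gword" where
  "winv w = rev (map (\<lambda>(x, b). (x, \<not> b)) w)"

definition wmap :: "('g \<Rightarrow> 'h) \<Rightarrow> 'g gword \<Rightarrow> 'h gword" where
  "wmap f w = map (\<lambda>(x, b). (f x, b)) w"

definition enc_word :: "('g \<Rightarrow> nat) \<Rightarrow> 'g gword \<Rightarrow> nat" where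
  "enc_word e w = list_encode (map (\<lambda>(x, b). prod_encode (e x, enc_bool b)) w)"

lemma enc_word_inj: "inj e \<Longrightarrow> inj (enc_word e)"
proof -
  assume "inj e"
  then have "inj (\<lambda>(x, b). prod_encode (e x, enc_bool b))"
    using enc_bool_inj by (auto simp: inj_def)
  then show ?thesis
    unfolding enc_word_def inj_def using inj_mapI[of "\<lambda>(x, b). prod_encode (e x, enc_bool b)"]
    by (auto simp: inj_def list_encode_eq)
qed

text \<open>Equality of words in the group presented by generators \<open>X\<close> and relators \<open>R\<close>.\<close>

inductive word_eq :: "'g set \<Rightarrow> 'g gword set \<Rightarrow> 'g gword \<Rightarrow> 'g gword \<Rightarrow> bool" for X R where
  refl: "w \<in> words X \<Longrightarrow> word_eq X R w w"
| sym: "word_eq X R v w \<Longrightarrow> word_eq X R w v"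
| trans: "word_eq X R u v \<Longrightarrow> word_eq X R v w \<Longrightarrow> word_eq X R u w"
| cancel: "u \<in> words X \<Longrightarrow> v \<in> words X \<Longrightarrow> x \<in> X \<Longrightarrow>
    word_eq X R (u @ [(x, b), (x, \<not> b)] @ v) (u @ v)"
| relator: "u \<in> words X \<Longrightarrow> v \<in> words X \<Longrightarrow> r \<in> R \<Longrightarrow> word_eq X R (u @ r @ v) (u @ v)"

definition cls :: "'g set \<Rightarrow> 'g gword set \<Rightarrow> 'g gword \<Rightarrow> 'g gword set" where
  "cls X R w = {v. word_eq X R w v}"

definition pres_group :: "'g set \<Rightarrow> 'g gword set \<Rightarrow> 'g gword set monoid" where
  "pres_group X R =
    \<lparr>carrier = cls X R ` words X,
     monoid.mult = (\<lambda>P Q. {w. \<exists>p\<in>P. \<exists>q\<in>Q. word_eq X R (p @ q) w}),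
     one = cls X R []\<rparr>"

definition finite_presentation :: "'g set \<Rightarrow> 'g gword set \<Rightarrow> bool" where
  "finite_presentation X R \<longleftrightarrow> finite X \<and> finite R \<and> R \<subseteq> words X"

lemma words_simps [simp]:
  "[] \<in> words X"
  "a # w \<in> words X \<longleftrightarrow> fst a \<in> X \<and> w \<in> words X"
  "u @ v \<in> words X \<longleftrightarrow> u \<in> words X \<and> v \<in> words X"
  "winv w \<in> words X \<longleftrightarrow> w \<in> words X"
  by (force simp: words_def winv_def mem_Times_iff in_lists_conv_set)+

lemma word_eq_words:
  assumes "R \<subseteq> words X" "word_eq X R u v"
  shows "u \<in> words X \<and> v \<in> words X"
  using assms(2) by induction (use assms(1) in auto)

lemma word_eq_context:
  assumes "word_eq X R u v" "p \<in> words X" "q \<in> words X"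
  shows "word_eq X R (p @ u @ q) (p @ v @ q)"
  using assms
proof induction
  case (refl w) then show ?case by (auto intro: word_eq.refl)
next
  case (sym v w) then show ?case by (auto intro: word_eq.sym)
next
  case (trans u v w) then show ?case by (auto intro: word_eq.trans)
next
  case (cancel u v x b)
  then show ?case using word_eq.cancel[of "p @ u" X "v @ q" x R b] by simp
next
  case (relator u v r)
  then show ?case using word_eq.relator[of "p @ u" X "v @ q" r R] by simp
qed

lemma word_eq_append:
  assumes "R \<subseteq> words X" "word_eq X R u u'" "word_eq X R v v'"
  shows "word_eq X R (u @ v) (u' @ v')"
proof (rule word_eq.trans)
  show "word_eq X R (u @ v) (u' @ v)"
    using word_eq_context[OF assms(2), of "[]" v] word_eq_words[OF assms(1,3)] by simp
  show "word_eq X R (u' @ v) (u' @ v')"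
    using word_eq_context[OF assms(3), of u' "[]"] word_eq_words[OF assms(1,2)] by simp
qed

lemma word_eq_winv: "w \<in> words X \<Longrightarrow> word_eq X R (winv w @ w) []"
proof (induction w)
  case Nil then show ?case by (auto simp: winv_def intro: word_eq.refl)
next
  case (Cons a w)
  obtain x b where [simp]: "a = (x, b)" by (cases a)
  have "word_eq X R (winv w @ [(x, \<not> b), (x, \<not> \<not> b)] @ w) (winv w @ w)"
    using Cons.prems by (intro word_eq.cancel) auto
  then show ?case using Cons by (auto simp: winv_def intro: word_eq.trans)
qed

lemma cls_eq_iff: "v \<in> words X \<Longrightarrow> cls X R u = cls X R v \<longleftrightarrow> word_eq X R u v"
  unfolding cls_def using word_eq.refl word_eq.sym word_eq.trans by fast

lemma pres_group_mult:
  assumes "R \<subseteq> words X" "u \<in> words X" "v \<in> words X"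
  shows "cls X R u \<otimes>\<^bsub>pres_group X R\<^esub> cls X R v = cls X R (u @ v)"
proof -
  have "(\<exists>p\<in>cls X R u. \<exists>q\<in>cls X R v. word_eq X R (p @ q) w) \<longleftrightarrow> word_eq X R (u @ v) w" for w
    using word_eq_append[OF assms(1)] word_eq.refl[OF assms(2)] word_eq.refl[OF assms(3)]
    unfolding cls_def by (blast intro: word_eq.trans)
  then show ?thesis by (simp add: pres_group_def cls_def)
qed

lemma pres_group_carrier: "carrier (pres_group X R) = cls X R ` words X"
  by (simp add: pres_group_def)

lemma pres_group_one: "\<one>\<^bsub>pres_group X R\<^esub> = cls X R []"
  by (simp add: pres_group_def)

lemma group_pres_group:
  assumes "R \<subseteq> words X"
  shows "group (pres_group X R)"
proof (rule groupI)
  fix x assume "x \<in> carrier (pres_group X R)"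
  then obtain w where w: "w \<in> words X" "x = cls X R w" by (auto simp: pres_group_carrier)
  have "cls X R (winv w) \<otimes>\<^bsub>pres_group X R\<^esub> x = \<one>\<^bsub>pres_group X R\<^esub>"
    using w pres_group_mult[OF assms] word_eq_winv[OF w(1)]
    by (simp add: pres_group_one cls_eq_iff)
  then show "\<exists>y\<in>carrier (pres_group X R). y \<otimes>\<^bsub>pres_group X R\<^esub> x = \<one>\<^bsub>pres_group X R\<^esub>"
    using w by (auto simp: pres_group_carrier)
qed (auto simp: pres_group_carrier pres_group_one pres_group_mult[OF assms])


section \<open>Amalgamated products\<close>

text \<open>Generators and relators of \<open>\<langle>X \<union> Y | R\<^sub>A, R\<^sub>B, u\<^sub>i = v\<^sub>i\<rangle>\<close>, the union of \<open>X\<close> and \<open>Y\<close> being disjoint.\<close>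

definition amalg_gens :: "nat set \<Rightarrow> nat set \<Rightarrow> (nat + nat) set" where
  "amalg_gens X Y = X <+> Y"

definition amalg_rels ::
    "nat gword set \<Rightarrow> nat gword set \<Rightarrow> nat gword list \<Rightarrow> nat gword list \<Rightarrow> (nat + nat) gword set" where
  "amalg_rels RA RB us vs =
     wmap Inl ` RA \<union> wmap Inr ` RB \<union>
     {wmap Inl u @ winv (wmap Inr v) | u v. (u, v) \<in> set (zip us vs)}"

text \<open>The homomorphism into \<open>pres_group X R\<close> induced by a map \<open>f\<close> of generators.\<close>

definition induced_map ::
    "'h set \<Rightarrow> 'h gword set \<Rightarrow> ('g \<Rightarrow> 'h) \<Rightarrow> 'g gword set \<Rightarrow> 'h gword set" where
  "induced_map X R f P = {w. \<exists>p\<in>P. word_eq X R (wmap f p) w}"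


section \<open>Black holes\<close>

definition conj_set :: "('a, 'm) monoid_scheme \<Rightarrow> 'a set \<Rightarrow> 'a \<Rightarrow> 'a set" where
  "conj_set H K g = {inv\<^bsub>H\<^esub> g \<otimes>\<^bsub>H\<^esub> k \<otimes>\<^bsub>H\<^esub> g | k. k \<in> K}"

definition Nstar :: "('a, 'm) monoid_scheme \<Rightarrow> 'a set \<Rightarrow> 'a set" where
  "Nstar H C = {g \<in> carrier H. C \<inter> conj_set H C g \<noteq> {\<one>\<^bsub>H\<^esub>}}"

definition Zset :: "('a, 'm) monoid_scheme \<Rightarrow> 'a set \<Rightarrow> 'a set" where
  "Zset H C = (\<Union>g \<in> Nstar H C - C. conj_set H C (inv\<^bsub>H\<^esub> g) \<inter> C)"

definition black_hole :: "('a, 'm) monoid_scheme \<Rightarrow> 'a set \<Rightarrow> 'a set" where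
  "black_hole H C = (Nstar H C - C) \<union> Zset H C"

definition regular :: "('a, 'm) monoid_scheme \<Rightarrow> 'a set \<Rightarrow> 'a \<Rightarrow> bool" where
  "regular H C g \<longleftrightarrow> g \<in> carrier H - black_hole H C"


section \<open>Algorithmic problems\<close>

definition membership_problem :: "('g \<Rightarrow> nat) \<Rightarrow> 'g set \<Rightarrow> 'g gword set \<Rightarrow> 'g gword set set \<Rightarrow> bool" where
  "membership_problem e X R S \<longleftrightarrow>
     algorithm (enc_word e) enc_bool (words X) (\<lambda>w b. b \<longleftrightarrow> cls X R w \<in> S)"

text \<open>Value of a word whose \<open>i\<close>-th generator stands for the \<open>i\<close>-th entry of a tuple: as a word,
  for a tuple of words, and as a group element, for a tuple of elements.\<close>

definition subst_word :: "'g gword list \<Rightarrow> nat gword \<Rightarrow> 'g gword" where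
  "subst_word us w = concat (map (\<lambda>(i, b). if b then us ! i else winv (us ! i)) w)"

definition eval_word :: "('a, 'm) monoid_scheme \<Rightarrow> 'a list \<Rightarrow> nat gword \<Rightarrow> 'a" where
  "eval_word H zs w =
     foldr (\<lambda>(i, b) a. (if b then zs ! i else inv\<^bsub>H\<^esub> (zs ! i)) \<otimes>\<^bsub>H\<^esub> a) w \<one>\<^bsub>H\<^esub>"

definition membership_search_problem ::
    "nat set \<Rightarrow> nat gword set \<Rightarrow> nat gword list \<Rightarrow> nat gword set set \<Rightarrow> bool" where
  "membership_search_problem X R us K \<longleftrightarrow>
     algorithm (enc_word id) (enc_option (enc_word id)) (words X)
       (\<lambda>w r. case r of
          None \<Rightarrow> cls X R w \<notin> K
        | Some v \<Rightarrow> cls X R w \<in> K \<and> v \<in> words {..<length us} \<and>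
                    cls X R (subst_word us v) = cls X R w)"

definition coset_rep_search_problem ::
    "nat set \<Rightarrow> nat gword set \<Rightarrow> nat gword set set \<Rightarrow> bool" where
  "coset_rep_search_problem X R K \<longleftrightarrow>
     (\<exists>T \<subseteq> carrier (pres_group X R).
        (\<forall>D \<in> rcosets\<^bsub>pres_group X R\<^esub> K. \<exists>!t. t \<in> T \<inter> D) \<and>
        membership_problem id X R T \<and>
        algorithm (enc_word id) (enc_word id) (words X)
          (\<lambda>w v. v \<in> words X \<and> cls X R v \<in> T \<inter> (K #>\<^bsub>pres_group X R\<^esub> cls X R w)))"

definition Sub :: "('a, 'm) monoid_scheme \<Rightarrow> 'a set \<Rightarrow> 'a set set" where
  "Sub H C = {K. subgroup K H \<and> K \<subseteq> C}"

inductive_set Phi :: "'a set set \<Rightarrow> ('a, 'm) monoid_scheme \<Rightarrow> 'a set set" for M H where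
  base: "K \<in> M \<Longrightarrow> K \<in> Phi M H"
| shift: "D \<in> Phi M H \<Longrightarrow> u \<in> carrier H \<Longrightarrow> v \<in> carrier H \<Longrightarrow> (u <#\<^bsub>H\<^esub> D) #>\<^bsub>H\<^esub> v \<in> Phi M H"
| inter: "D \<in> Phi M H \<Longrightarrow> E \<in> Phi M H \<Longrightarrow> D \<inter> E \<in> Phi M H"


subsection \<open>Effective descriptions\<close>

datatype factor = FactorA | FactorB

text \<open>\<open>set_expr\<close> describes members of \<open>\<Phi>(Sub(C), H)\<close>, and \<open>sub_expr\<close> describes subgroups of \<open>C\<close>.
  A finite generating tuple is given by words in the generators of \<open>C\<close>. \<open>Translate H D h\<close> stands for
  \<open>D h\<^sup>-\<^sup>1\<close> where \<open>D\<close> is taken in the factor \<open>H\<close>, which need not be the factor in which the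
  resulting subgroup is used.\<close>

datatype set_expr =
    Base sub_expr
  | Shift "nat gword" set_expr "nat gword"
  | Inter set_expr set_expr
and sub_expr =
    Generated "nat gword list"
  | Translate factor set_expr "nat gword"

context
  fixes X :: "factor \<Rightarrow> nat set" and R :: "factor \<Rightarrow> nat gword set"
    and C :: "('c, 'm) monoid_scheme" and zs :: "'c list"
    and emb :: "factor \<Rightarrow> 'c \<Rightarrow> nat gword set"
begin

primrec set_of_expr :: "set_expr \<Rightarrow> factor \<Rightarrow> nat gword set set"
  and sub_of_expr :: "sub_expr \<Rightarrow> 'c set" where
  "set_of_expr (Base K) = (\<lambda>H. emb H ` sub_of_expr K)"
| "set_of_expr (Shift u D v) = (\<lambda>H.
     (cls (X H) (R H) u <#\<^bsub>pres_group (X H) (R H)\<^esub> set_of_expr D H)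
        #>\<^bsub>pres_group (X H) (R H)\<^esub> cls (X H) (R H) v)"
| "set_of_expr (Inter D E) = (\<lambda>H. set_of_expr D H \<inter> set_of_expr E H)"
| "sub_of_expr (Generated ws) = generate C (eval_word C zs ` set ws)"
| "sub_of_expr (Translate H D h) =
     {c \<in> carrier C. emb H c \<in> set_of_expr D H #>\<^bsub>pres_group (X H) (R H)\<^esub>
        inv\<^bsub>pres_group (X H) (R H)\<^esub> (cls (X H) (R H) h)}"

primrec valid_set_expr :: "set_expr \<Rightarrow> factor \<Rightarrow> bool"
  and valid_sub_expr :: "sub_expr \<Rightarrow> bool" where
  "valid_set_expr (Base K) = (\<lambda>H. valid_sub_expr K)"
| "valid_set_expr (Shift u D v) = (\<lambda>H.
     u \<in> words (X H) \<and> v \<in> words (X H) \<and> valid_set_expr D H)"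
| "valid_set_expr (Inter D E) = (\<lambda>H. valid_set_expr D H \<and> valid_set_expr E H)"
| "valid_sub_expr (Generated ws) = (set ws \<subseteq> words {..<length zs})"
| "valid_sub_expr (Translate H D h) =
     (valid_set_expr D H \<and> set_of_expr D H \<subseteq> emb H ` carrier C \<and>
      h \<in> words (X H) \<and> cls (X H) (R H) h \<in> set_of_expr D H)"

end

text \<open>Valid expressions do describe members of \<open>\<Phi>(Sub(C), H)\<close> and subgroups of \<open>C\<close>: every
  \<open>D \<in> \<Phi>(Sub(C), H)\<close> is closed under \<open>a b\<^sup>-\<^sup>1 c\<close>.\<close>

lemma Phi_ternary:
  assumes "group H" and "D \<in> Phi (Sub H K) H"
  shows "D \<subseteq> carrier H \<and> (\<forall>a\<in>D. \<forall>b\<in>D. \<forall>c\<in>D. a \<otimes>\<^bsub>H\<^esub> inv\<^bsub>H\<^esub> b \<otimes>\<^bsub>H\<^esub> c \<in> D)"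
proof -
  interpret H: group H by fact
  show ?thesis using assms(2)
  proof induction
    case (base L)
    then interpret L: subgroup L H by (simp add: Sub_def)
    show ?case by (blast intro: L.m_closed L.m_inv_closed L.mem_carrier)
  next
    case (shift D u v)
    have eq: "(u <#\<^bsub>H\<^esub> D) #>\<^bsub>H\<^esub> v = (\<lambda>d. u \<otimes>\<^bsub>H\<^esub> d \<otimes>\<^bsub>H\<^esub> v) ` D"
      by (auto simp: l_coset_def r_coset_def)
    have *: "(u \<otimes>\<^bsub>H\<^esub> a \<otimes>\<^bsub>H\<^esub> v) \<otimes>\<^bsub>H\<^esub> inv\<^bsub>H\<^esub> (u \<otimes>\<^bsub>H\<^esub> b \<otimes>\<^bsub>H\<^esub> v) \<otimes>\<^bsub>H\<^esub> (u \<otimes>\<^bsub>H\<^esub> c \<otimes>\<^bsub>H\<^esub> v)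
        = u \<otimes>\<^bsub>H\<^esub> (a \<otimes>\<^bsub>H\<^esub> inv\<^bsub>H\<^esub> b \<otimes>\<^bsub>H\<^esub> c) \<otimes>\<^bsub>H\<^esub> v"
      if "a \<in> carrier H" "b \<in> carrier H" "c \<in> carrier H" for a b c
    proof -
      have cancel: "inv\<^bsub>H\<^esub> x \<otimes>\<^bsub>H\<^esub> (x \<otimes>\<^bsub>H\<^esub> y) = y" "x \<otimes>\<^bsub>H\<^esub> (inv\<^bsub>H\<^esub> x \<otimes>\<^bsub>H\<^esub> y) = y"
        if "x \<in> carrier H" "y \<in> carrier H" for x y
        using that H.m_assoc[of "inv\<^bsub>H\<^esub> x" x y] H.m_assoc[of x "inv\<^bsub>H\<^esub> x" y] by simp_all
      show ?thesis using that shift.hyps by (simp only: H.m_assoc H.inv_mult_group cancel H.m_closed H.inv_closed)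
    qed
    show ?case unfolding eq
    proof (intro conjI ballI)
      show "(\<lambda>d. u \<otimes>\<^bsub>H\<^esub> d \<otimes>\<^bsub>H\<^esub> v) ` D \<subseteq> carrier H"
        using shift.hyps shift.IH by (blast intro: H.m_closed)
    next
      fix a b c assume "a \<in> (\<lambda>d. u \<otimes>\<^bsub>H\<^esub> d \<otimes>\<^bsub>H\<^esub> v) ` D" "b \<in> (\<lambda>d. u \<otimes>\<^bsub>H\<^esub> d \<otimes>\<^bsub>H\<^esub> v) ` D"
        "c \<in> (\<lambda>d. u \<otimes>\<^bsub>H\<^esub> d \<otimes>\<^bsub>H\<^esub> v) ` D"
      then obtain a' b' c' where "a' \<in> D" "b' \<in> D" "c' \<in> D" "a = u \<otimes>\<^bsub>H\<^esub> a' \<otimes>\<^bsub>H\<^esub> v"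
        "b = u \<otimes>\<^bsub>H\<^esub> b' \<otimes>\<^bsub>H\<^esub> v" "c = u \<otimes>\<^bsub>H\<^esub> c' \<otimes>\<^bsub>H\<^esub> v" by blast
      moreover have "a' \<otimes>\<^bsub>H\<^esub> inv\<^bsub>H\<^esub> b' \<otimes>\<^bsub>H\<^esub> c' \<in> D" using calculation shift.IH by blast
      moreover have "a' \<in> carrier H" "b' \<in> carrier H" "c' \<in> carrier H"
        using calculation shift.IH by blast+
      ultimately show "a \<otimes>\<^bsub>H\<^esub> inv\<^bsub>H\<^esub> b \<otimes>\<^bsub>H\<^esub> c \<in> (\<lambda>d. u \<otimes>\<^bsub>H\<^esub> d \<otimes>\<^bsub>H\<^esub> v) ` D"
        by (simp add: *)
    qed
  next
    case (inter D E) then show ?case by blast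
  qed
qed

lemma subgroup_translate:
  assumes "group C" "group H" "f \<in> hom C H" "D \<subseteq> carrier H" "h \<in> D"
    and t: "\<And>a b c. a \<in> D \<Longrightarrow> b \<in> D \<Longrightarrow> c \<in> D \<Longrightarrow> a \<otimes>\<^bsub>H\<^esub> inv\<^bsub>H\<^esub> b \<otimes>\<^bsub>H\<^esub> c \<in> D"
  shows "subgroup {c \<in> carrier C. f c \<in> D #>\<^bsub>H\<^esub> inv\<^bsub>H\<^esub> h} C"
proof -
  interpret C: group C by fact
  interpret H: group H by fact
  interpret group_hom C H f by unfold_locales fact
  have h: "h \<in> carrier H" using assms(4,5) by auto
  have mem: "x \<in> D #>\<^bsub>H\<^esub> inv\<^bsub>H\<^esub> h \<longleftrightarrow> x \<otimes>\<^bsub>H\<^esub> h \<in> D" if "x \<in> carrier H" for x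
  proof
    assume "x \<in> D #>\<^bsub>H\<^esub> inv\<^bsub>H\<^esub> h"
    then obtain d where "d \<in> D" "x = d \<otimes>\<^bsub>H\<^esub> inv\<^bsub>H\<^esub> h" by (auto simp: r_coset_def)
    then show "x \<otimes>\<^bsub>H\<^esub> h \<in> D" using h assms(4) by (auto simp: H.m_assoc subset_iff)
  next
    assume "x \<otimes>\<^bsub>H\<^esub> h \<in> D"
    moreover have "x = (x \<otimes>\<^bsub>H\<^esub> h) \<otimes>\<^bsub>H\<^esub> inv\<^bsub>H\<^esub> h" using h that by (simp add: H.m_assoc)
    ultimately show "x \<in> D #>\<^bsub>H\<^esub> inv\<^bsub>H\<^esub> h" unfolding r_coset_def by blast
  qed
  have "{c \<in> carrier C. f c \<in> D #>\<^bsub>H\<^esub> inv\<^bsub>H\<^esub> h} = {c \<in> carrier C. f c \<otimes>\<^bsub>H\<^esub> h \<in> D}"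
    using mem by auto
  moreover have "subgroup {c \<in> carrier C. f c \<otimes>\<^bsub>H\<^esub> h \<in> D} C"
  proof (rule C.subgroupI)
    show "{c \<in> carrier C. f c \<otimes>\<^bsub>H\<^esub> h \<in> D} \<noteq> {}"
      using assms(5) h by (auto intro!: exI[of _ "\<one>\<^bsub>C\<^esub>"])
  next
    fix a assume a: "a \<in> {c \<in> carrier C. f c \<otimes>\<^bsub>H\<^esub> h \<in> D}"
    have "h \<otimes>\<^bsub>H\<^esub> inv\<^bsub>H\<^esub> (f a \<otimes>\<^bsub>H\<^esub> h) \<otimes>\<^bsub>H\<^esub> h \<in> D" using a t assms(5) by blast
    moreover have "h \<otimes>\<^bsub>H\<^esub> inv\<^bsub>H\<^esub> (f a \<otimes>\<^bsub>H\<^esub> h) = f (inv\<^bsub>C\<^esub> a)"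
      using a h H.m_assoc[of h "inv\<^bsub>H\<^esub> h" "inv\<^bsub>H\<^esub> f a"] by (simp add: H.inv_mult_group)
    ultimately show "inv\<^bsub>C\<^esub> a \<in> {c \<in> carrier C. f c \<otimes>\<^bsub>H\<^esub> h \<in> D}" using a by auto
  next
    fix a b assume ab: "a \<in> {c \<in> carrier C. f c \<otimes>\<^bsub>H\<^esub> h \<in> D}" "b \<in> {c \<in> carrier C. f c \<otimes>\<^bsub>H\<^esub> h \<in> D}"
    then have "(f a \<otimes>\<^bsub>H\<^esub> h) \<otimes>\<^bsub>H\<^esub> inv\<^bsub>H\<^esub> h \<otimes>\<^bsub>H\<^esub> (f b \<otimes>\<^bsub>H\<^esub> h) \<in> D" using t assms(5) by blast
    moreover have "(f a \<otimes>\<^bsub>H\<^esub> h) \<otimes>\<^bsub>H\<^esub> inv\<^bsub>H\<^esub> h = f a" using ab h by (simp add: H.m_assoc)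
    ultimately show "a \<otimes>\<^bsub>C\<^esub> b \<in> {c \<in> carrier C. f c \<otimes>\<^bsub>H\<^esub> h \<in> D}"
      using ab h by (simp add: H.m_assoc)
  qed auto
  ultimately show ?thesis by simp
qed

lemma eval_word_closed:
  assumes "group C" "set zs \<subseteq> carrier C" "w \<in> words {..<length zs}"
  shows "eval_word C zs w \<in> carrier C"
  using assms(3)
proof (induction w)
  case Nil then show ?case using assms(1) by (simp add: eval_word_def group.is_monoid)
next
  case (Cons a w)
  interpret group C by fact
  obtain i b where [simp]: "a = (i, b)" by (cases a)
  have "zs ! i \<in> carrier C" using Cons.prems assms(2) nth_mem by fastforce
  then show ?case using Cons by (simp add: eval_word_def)
qed

lemma valid_expr:
  assumes "group C" "set zs \<subseteq> carrier C" "\<And>H. R H \<subseteq> words (X H)"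
    and "\<And>H. emb H \<in> hom C (pres_group (X H) (R H))"
  shows "valid_set_expr X R C zs emb D H \<Longrightarrow> set_of_expr X R C zs emb D H
           \<in> Phi (Sub (pres_group (X H) (R H)) (emb H ` carrier C)) (pres_group (X H) (R H))"
    and "valid_sub_expr X R C zs emb K \<Longrightarrow> subgroup (sub_of_expr X R C zs emb K) C"
proof (induction D and K arbitrary: H)
  case (Base K)
  interpret group_hom C "pres_group (X H) (R H)" "emb H"
    using assms group_pres_group[OF assms(3)]
    by (simp add: group_hom_def group_hom_axioms_def)
  have "subgroup (sub_of_expr X R C zs emb K) C" using Base by simp
  then have "emb H ` sub_of_expr X R C zs emb K \<in> Sub (pres_group (X H) (R H)) (emb H ` carrier C)"
    using subgroup_img_is_subgroup by (auto simp: Sub_def dest: subgroup.mem_carrier)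
  then show ?case by (simp add: Phi.base)
next
  case (Shift u D v)
  then show ?case by (auto simp: pres_group_carrier intro!: Phi.shift)
next
  case (Inter D E)
  then show ?case by (auto intro: Phi.inter)
next
  case (Generated ws)
  interpret group C by fact
  show ?case using Generated eval_word_closed[OF assms(1,2)]
    by (auto intro!: generate_is_subgroup)
next
  case (Translate H D h)
  let ?H = "pres_group (X H) (R H)"
  note H = group_pres_group[OF assms(3)[of H]]
  have "set_of_expr X R C zs emb D H \<in> Phi (Sub ?H (emb H ` carrier C)) ?H"
    using Translate by simp
  note * = Phi_ternary[OF H this]
  show ?case
    using subgroup_translate[OF assms(1) H assms(4), of "set_of_expr X R C zs emb D H"
        "cls (X H) (R H) h"] * Translate.prems by simp
qed

primrec enc_factor :: "factor \<Rightarrow> nat" where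
  "enc_factor FactorA = 0"
| "enc_factor FactorB = 1"

primrec enc_set_expr :: "set_expr \<Rightarrow> nat" and enc_sub_expr :: "sub_expr \<Rightarrow> nat" where
  "enc_set_expr (Base K) = prod_encode (0, enc_sub_expr K)"
| "enc_set_expr (Shift u D v) =
     prod_encode (1, prod_encode (enc_word id u, prod_encode (enc_set_expr D, enc_word id v)))"
| "enc_set_expr (Inter D E) = prod_encode (2, prod_encode (enc_set_expr D, enc_set_expr E))"
| "enc_sub_expr (Generated ws) = prod_encode (0, list_encode (map (enc_word id) ws))"
| "enc_sub_expr (Translate H D h) =
     prod_encode (1, prod_encode (enc_factor H, prod_encode (enc_set_expr D, enc_word id h)))"

lemma enc_expr_inj_aux:
  "(\<forall>E. enc_set_expr D = enc_set_expr E \<longrightarrow> D = E) \<and> (\<forall>L. enc_sub_expr K = enc_sub_expr L \<longrightarrow> K = L)"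
proof -
  have w: "enc_word id u = enc_word id v \<longleftrightarrow> u = v" for u v
    using enc_word_inj[of id] by (auto simp: inj_def)
  have m: "map (enc_word id) us = map (enc_word id) vs \<longleftrightarrow> us = vs" for us vs
    using enc_word_inj[of id] by (simp add: inj_map_eq_map)
  have f: "enc_factor H = enc_factor H' \<longleftrightarrow> H = H'" for H H'
    by (cases H; cases H') auto
  have "(\<forall>E. enc_set_expr D = enc_set_expr E \<longrightarrow> D = E)" "(\<forall>L. enc_sub_expr K = enc_sub_expr L \<longrightarrow> K = L)"
  proof (induction D and K)
    case (Base K) show ?case
    proof (intro allI impI)
      fix E assume "enc_set_expr (Base K) = enc_set_expr E"
      then show "Base K = E" using Base by (cases E) auto
    qed
  next
    case (Shift u D v) show ?case
    proof (intro allI impI)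
      fix E assume "enc_set_expr (Shift u D v) = enc_set_expr E"
      then show "Shift u D v = E" using Shift by (cases E) (auto simp: w)
    qed
  next
    case (Inter D D') show ?case
    proof (intro allI impI)
      fix E assume "enc_set_expr (Inter D D') = enc_set_expr E"
      then show "Inter D D' = E" using Inter by (cases E) auto
    qed
  next
    case (Generated ws) show ?case
    proof (intro allI impI)
      fix L assume "enc_sub_expr (Generated ws) = enc_sub_expr L"
      then show "Generated ws = L" by (cases L) (auto simp: m list_encode_eq)
    qed
  next
    case (Translate H D h) show ?case
    proof (intro allI impI)
      fix L assume "enc_sub_expr (Translate H D h) = enc_sub_expr L"
      then show "Translate H D h = L" using Translate by (cases L) (auto simp: w f)
    qed
  qed
  then show ?thesis by blast
qed

lemma enc_set_expr_inj: "inj enc_set_expr"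
  using enc_expr_inj_aux by (auto simp: inj_def)


subsection \<open>Cardinality Search Problem\<close>

datatype card_answer = Is_empty | Is_infinite | Is_finite "nat gword list"

definition enc_card_answer :: "card_answer \<Rightarrow> nat" where
  "enc_card_answer a = (case a of Is_empty \<Rightarrow> 0 | Is_infinite \<Rightarrow> 1
     | Is_finite ws \<Rightarrow> list_encode (map (enc_word id) ws) + 2)"

lemma enc_card_answer_inj: "inj enc_card_answer"
  using inj_map_eq_map[OF enc_word_inj[of id]]
  by (auto simp: inj_on_def enc_card_answer_def list_encode_eq split: card_answer.splits)

definition correct_card_answer ::
    "nat set \<Rightarrow> nat gword set \<Rightarrow> nat gword set set \<Rightarrow> card_answer \<Rightarrow> bool" where
  "correct_card_answer X R D a \<longleftrightarrow> (case a of
       Is_empty \<Rightarrow> D = {}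
     | Is_infinite \<Rightarrow> infinite D
     | Is_finite ws \<Rightarrow> finite D \<and> D \<noteq> {} \<and> set ws \<subseteq> words X \<and> cls X R ` set ws = D)"

definition cardinality_search_problem ::
    "(factor \<Rightarrow> nat set) \<Rightarrow> (factor \<Rightarrow> nat gword set) \<Rightarrow> ('c, 'm) monoid_scheme \<Rightarrow> 'c list \<Rightarrow>
     (factor \<Rightarrow> 'c \<Rightarrow> nat gword set) \<Rightarrow> factor \<Rightarrow> bool" where
  "cardinality_search_problem X R C zs emb H \<longleftrightarrow>
     algorithm enc_set_expr enc_card_answer
       {D. valid_set_expr X R C zs emb D H \<and>
           set_of_expr X R C zs emb D H
             \<in> Phi (Sub (pres_group (X H) (R H)) (emb H ` carrier C)) (pres_group (X H) (R H))}
       (\<lambda>D a. correct_card_answer (X H) (R H) (set_of_expr X R C zs emb D H) a)"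

end

theory Submission
  imports Defs
begin

text \<open>Every element of \<open>G\<close> is \<open>g\<^sub>1 \<cdots> g\<^sub>n c\<close> with syllables \<open>g\<^sub>i\<close> taken alternately from \<open>A \<setminus> C\<close> and
  \<open>B \<setminus> C\<close> and with \<open>c \<in> C\<close>; the Membership Search Problem for \<open>C\<close> suffices to compute such a
  form. By the normal form theorem an element of \<open>C\<close> that \<open>g\<^sub>1 \<cdots> g\<^sub>n\<close> conjugates into \<open>C\<close> stays in \<open>C\<close>
  after each single syllable. Hence \<open>Z\<^sub>G(C) = Z\<^sub>A(C) \<union> Z\<^sub>B(C)\<close>, which settles \<open>n = 0\<close>, and
  for \<open>n > 0\<close> the group \<open>C \<inter> g C g\<^sup>-\<^sup>1\<close> is obtained from \<open>C\<close> by the steps \<open>K \<mapsto> C \<inter> g\<^sub>i K g\<^sub>i\<^sup>-\<^sup>1\<close>, each of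
  which is an effective description; a Cardinality Search decides whether the result is trivial.

  The normal form theorem is proved by van der Waerden's method: \<open>A\<close> and \<open>B\<close> act on the set of
  normal forms, and the two actions agree on \<open>C\<close>.\<close>

section \<open>Computable functions between encoded types\<close>

text \<open>The syllables alternate between the factors, whereas a set expression lives in a single
  factor. What is carried along is therefore a description of a subgroup K of the abstract group C:
  a step forms the intersection of C with g K g^-1 inside the factor of the syllable g, and a
  translation with h = 1 turns this set back into a subgroup of C, ready for the other factor.
  Cardinality Search does not speak of triviality directly. The answer "infinite" settles the
  matter; a finite answer is a list of words that may name 1 repeatedly, so each listed word w is
  tested by asking whether the intersection of {w} and {1} is empty. The description of
  \<open>Zset\<close> for G rests on the first syllable of the conjugating element: it moves into C
  everything in C that the whole element moves into C, and the nontrivial element that puts the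
  whole into \<open>Nstar\<close> puts the syllable there too. The given algorithms are promised to
  halt on admissible inputs only, so computability is always relative to a set of inputs, and every
  call has to be shown to stay inside it.\<close>

definition computable :: "('a \<Rightarrow> nat) \<Rightarrow> ('b \<Rightarrow> nat) \<Rightarrow> 'a set \<Rightarrow> ('a \<Rightarrow> 'b) \<Rightarrow> bool" where
  "computable ei eo I f \<longleftrightarrow> algorithm ei eo I (\<lambda>x y. y = f x)"

lemma computableI: "partrec g \<Longrightarrow> (\<And>x. x \<in> I \<Longrightarrow> g (ei x) = Some (eo (f x))) \<Longrightarrow> computable ei eo I f"
  by (auto simp: computable_def algorithm_def)

lemma computableE:
  assumes "computable ei eo I f"
  obtains g where "partrec g" "\<And>x. x \<in> I \<Longrightarrow> g (ei x) = Some (eo (f x))"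
  using assms by (auto simp: computable_def algorithm_def)

text \<open>A specification that allows several answers does not compose. The machine itself is
  deterministic, so for each input one answer with the returned code is picked, and the oracle
  becomes a function.\<close>

lemma algorithm_choice:
  assumes "algorithm ei eo I P"
  obtains f where "computable ei eo I f" "\<And>x. x \<in> I \<Longrightarrow> P x (f x)"
proof -
  obtain g where g: "partrec g" "\<forall>x\<in>I. \<exists>y. P x y \<and> g (ei x) = Some (eo y)"
    using assms by (auto simp: algorithm_def)
  then obtain f where "\<forall>x\<in>I. P x (f x) \<and> g (ei x) = Some (eo (f x))"
    by metis
  with g(1) show thesis by (intro that[of f] computableI[of g]) auto
qed

lemma algorithmI: "computable ei eo I f \<Longrightarrow> (\<And>x. x \<in> I \<Longrightarrow> P x (f x)) \<Longrightarrow> algorithm ei eo I P"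
  unfolding computable_def algorithm_def by blast

definition enc_pair :: "('a \<Rightarrow> nat) \<Rightarrow> ('b \<Rightarrow> nat) \<Rightarrow> 'a \<times> 'b \<Rightarrow> nat" where
  "enc_pair ea eb p = prod_encode (ea (fst p), eb (snd p))"

definition enc_list :: "('a \<Rightarrow> nat) \<Rightarrow> 'a list \<Rightarrow> nat" where
  "enc_list e xs = list_encode (map e xs)"

abbreviation enc_letter :: "nat \<times> bool \<Rightarrow> nat" where
  "enc_letter \<equiv> enc_pair id enc_bool"

lemma enc_word_eq: "enc_word e = enc_list (enc_pair e enc_bool)"
  by (simp add: enc_word_def enc_list_def enc_pair_def[abs_def] fun_eq_iff split_def)

lemma inj_enc_pair: "inj ea \<Longrightarrow> inj eb \<Longrightarrow> inj (enc_pair ea eb)"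
  by (auto simp: inj_def enc_pair_def)

section \<open>Constants, composition and pairing\<close>

lemma partrec_id: "partrec (\<lambda>n. Some n)"
  using partrec.pair[OF partrec.left partrec.right] by simp

lemma partrec_const: "partrec (\<lambda>n. Some k)"
proof (induction k)
  case 0 show ?case by (rule partrec.zero)
next
  case (Suc k)
  from partrec.comp[OF partrec.succ this] show ?case by simp
qed

lemma computable_mono: "computable ei eo J f \<Longrightarrow> I \<subseteq> J \<Longrightarrow> computable ei eo I f"
  by (auto simp: computable_def algorithm_def subset_iff)

lemma computable_cong:
  "computable ei eo I g \<Longrightarrow> (\<And>x. x \<in> I \<Longrightarrow> f x = g x) \<Longrightarrow> computable ei eo I f"
  by (auto simp: computable_def algorithm_def)

lemma computable_id: "computable e e I (\<lambda>x. x)"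
  by (rule computableI[OF partrec_id]) simp

lemma computable_encode: "computable e id I e"
  by (rule computableI[OF partrec_id]) simp

lemma computable_const: "computable ei eo I (\<lambda>_. c)"
  by (rule computableI[OF partrec_const]) simp

lemma computable_comp:
  assumes "computable em eo J g" "computable ei em I f" "\<And>x. x \<in> I \<Longrightarrow> f x \<in> J"
  shows "computable ei eo I (\<lambda>x. g (f x))"
proof -
  obtain g' f' where "partrec g'" "\<And>x. x \<in> J \<Longrightarrow> g' (em x) = Some (eo (g x))"
    and "partrec f'" "\<And>x. x \<in> I \<Longrightarrow> f' (ei x) = Some (em (f x))"
    using assms(1,2) by (metis computableE)
  then show ?thesis
    by (intro computableI[OF partrec.comp[of g' f']]) (auto simp: assms(3))
qed

lemma computable_Pair:
  assumes "computable ei ea I f" "computable ei eb I g"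
  shows "computable ei (enc_pair ea eb) I (\<lambda>x. (f x, g x))"
proof -
  obtain g' f' where "partrec g'" "\<And>x. x \<in> I \<Longrightarrow> g' (ei x) = Some (eb (g x))"
    and "partrec f'" "\<And>x. x \<in> I \<Longrightarrow> f' (ei x) = Some (ea (f x))"
    using assms(1,2) by (metis computableE)
  then show ?thesis
    by (intro computableI[OF partrec.pair[of f' g']]) (auto simp: enc_pair_def)
qed

lemma computable_fst: "computable (enc_pair ea eb) ea I fst"
  by (rule computableI[OF partrec.left]) (simp add: enc_pair_def)

lemma computable_snd: "computable (enc_pair ea eb) eb I snd"
  by (rule computableI[OF partrec.right]) (simp add: enc_pair_def)

lemma computable_fst': "computable ei (enc_pair ea eb) I f \<Longrightarrow> computable ei ea I (\<lambda>x. fst (f x))"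
  by (rule computable_comp[OF computable_fst]) auto

lemma computable_snd': "computable ei (enc_pair ea eb) I f \<Longrightarrow> computable ei eb I (\<lambda>x. snd (f x))"
  by (rule computable_comp[OF computable_snd]) auto


text \<open>Primitive recursion makes branching lazy: \<open>f\<close> is not run when the condition fails.\<close>

lemma partrec_guard:
  assumes "partrec f" "partrec p"
  shows "partrec (\<lambda>a. Option.bind (p a) (\<lambda>n. if n = 0 then Some 0 else f a))"
proof -
  have *: "rec_nat (Some 0) (\<lambda>m r. Option.bind r (\<lambda>i. y)) n
      = (if n = 0 then Some 0 else y)" for n :: nat and y :: "nat option"
  proof (induction n)
    case (Suc n) then show ?case by (cases n; cases y) auto
  qed simp
  from partrec.comp[OF partrec.prec[OF partrec.zero partrec.comp[OF assms(1) partrec.left]]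
      partrec.pair[OF partrec_id assms(2)]]
  show ?thesis by (simp add: * cong: if_cong)
qed

text \<open>The strict half of branching: both candidates are already numbers, and recursion of
  depth zero or positive depth picks one of them.\<close>

lemma partrec_select:
  "partrec (\<lambda>p. Some (if snd (prod_decode p) = 0 then fst (prod_decode (fst (prod_decode p)))
                       else snd (prod_decode (fst (prod_decode p)))))"
proof -
  have *: "rec_nat (Some a) (\<lambda>m r. Option.bind r (\<lambda>i. Some b)) n
      = Some (if n = 0 then a else b)" for n a b :: nat
    by (induction n) auto
  from partrec.prec[OF partrec.left partrec.comp[OF partrec.right partrec.left]]
  show ?thesis by (simp add: *)
qed

text \<open>Pairing diverges as soon as one component does. Each branch is therefore guarded by the
  condition under which it is promised to halt; the branch not taken yields a dummy 0, and selection
  happens afterwards.\<close>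

lemma computable_if:
  assumes P: "computable ei enc_bool I P"
    and f: "computable ei eo {x \<in> I. P x} f" and g: "computable ei eo {x \<in> I. \<not> P x} g"
  shows "computable ei eo I (\<lambda>x. if P x then f x else g x)"
proof -
  obtain p where p: "partrec p" "\<And>x. x \<in> I \<Longrightarrow> p (ei x) = Some (enc_bool (P x))"
    using P by (metis computableE)
  obtain f' where f': "partrec f'" "\<And>x. x \<in> I \<Longrightarrow> P x \<Longrightarrow> f' (ei x) = Some (eo (f x))"
    using f by (metis (mono_tags, lifting) computableE mem_Collect_eq)
  obtain g' where g': "partrec g'" "\<And>x. x \<in> I \<Longrightarrow> \<not> P x \<Longrightarrow> g' (ei x) = Some (eo (g x))"
    using g by (metis (mono_tags, lifting) computableE mem_Collect_eq)
  define q where "q = (\<lambda>a. Option.bind (p a) (\<lambda>a. Some (if a = 0 then 1 else 0 :: nat)))"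
  have neg: "partrec (\<lambda>a. Some (if a = 0 then 1 else 0 :: nat))"
    \<comment> \<open>Selecting from the constant pair (1, 0) is the truth table of
      negation.\<close>
    using partrec.comp[OF partrec_select partrec.pair[OF partrec_const[of "prod_encode (1, 0)"] partrec_id]]
    by (simp cong: if_cong)
  have "partrec q"
    using partrec.comp[OF neg p(1)] by (simp add: q_def)
  have q: "q (ei x) = Some (enc_bool (\<not> P x))" if "x \<in> I" for x
    by (simp add: q_def p(2)[OF that] enc_bool_def)
  show ?thesis
    by (rule computableI[OF partrec.comp[OF partrec_select
          partrec.pair[OF partrec.pair[OF partrec_guard[OF g'(1) \<open>partrec q\<close>] partrec_guard[OF f'(1) p(1)]] p(1)]]])
      (auto simp: p(2) q f'(2) g'(2) enc_bool_def)
qed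

lemma computable_not:
  "computable ei enc_bool I P \<Longrightarrow> computable ei enc_bool I (\<lambda>x. \<not> P x)"
  by (rule computable_cong[OF computable_if[of ei I P enc_bool "\<lambda>_. False" "\<lambda>_. True"]])
    (auto intro: computable_const)

lemma computable_or:
  assumes "computable ei enc_bool I P" "computable ei enc_bool I Q"
  shows "computable ei enc_bool I (\<lambda>x. P x \<or> Q x)"
  by (rule computable_cong[OF computable_if[of ei I P enc_bool "\<lambda>_. True" Q]])
    (use assms in \<open>auto intro: computable_const computable_mono\<close>)

lemma computable_and:
  assumes "computable ei enc_bool I P" "computable ei enc_bool I Q"
  shows "computable ei enc_bool I (\<lambda>x. P x \<and> Q x)"
  by (rule computable_cong[OF computable_if[of ei I P enc_bool Q "\<lambda>_. False"]])
    (use assms in \<open>auto intro: computable_const computable_mono\<close>)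

section \<open>Arithmetic of codes and finite tables\<close>

lemma computable_Suc: "computable ei id I f \<Longrightarrow> computable ei id I (\<lambda>x. Suc (f x))"
  by (rule computable_comp[of id id UNIV Suc]) (auto intro: computableI[OF partrec.succ])

lemma partrec_pred: "partrec (\<lambda>n. Some (n - 1))"
proof -
  have *: "rec_nat (Some a) (\<lambda>m r. Option.bind r (\<lambda>i. Some m)) n = Some (if n = 0 then a else n - 1)" for n a :: nat
    by (induction n) auto
  from partrec.comp[OF partrec.prec[OF partrec.zero partrec.comp[OF partrec.left partrec.right]]
     partrec.pair[OF partrec.zero partrec_id]]
  moreover have "(\<lambda>n. Some (if n = 0 then 0 else n - 1)) = (\<lambda>n. Some (n - 1 :: nat))"
    by auto
  ultimately show ?thesis by (simp add: * cong: if_cong)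
qed

lemma computable_pred: "computable ei id I f \<Longrightarrow> computable ei id I (\<lambda>x. f x - 1)"
  by (rule computable_comp[of id id UNIV "\<lambda>n. n - 1"]) (auto intro: computableI[OF partrec_pred])

lemma computable_code: "computable ei eo I f \<Longrightarrow> computable ei id I (\<lambda>x. eo (f x))"
  by (simp add: computable_def algorithm_def)

lemma computable_eq_0:
  assumes "computable ei id I f"
  shows "computable ei enc_bool I (\<lambda>x. f x = 0)"
proof -
  obtain f' where f': "partrec f'" "\<And>x. x \<in> I \<Longrightarrow> f' (ei x) = Some (id (f x))"
    using assms by (metis computableE)
  show ?thesis
    by (rule computableI[OF partrec.comp[OF partrec_select partrec.pair[OF
        partrec_const[of "prod_encode (1, 0)"] f'(1)]]]) (auto simp: f'(2) enc_bool_def)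
qed

lemma computable_eq_const: "computable ei id I f \<Longrightarrow> computable ei enc_bool I (\<lambda>x. f x = k)"
proof (induction k arbitrary: f)
  case 0 then show ?case by (rule computable_eq_0)
next
  case (Suc k)
  show ?case
    by (rule computable_cong[OF computable_and[OF computable_not[OF computable_eq_0[OF Suc.prems]]
        Suc.prems[THEN computable_pred, THEN Suc.IH]]]) auto
qed

text \<open>A lookup table, written as a cascade of comparisons with fixed codes; injectivity of the
  code on the domain makes each comparison exact. Generators, letters and factors are handled this
  way.\<close>

lemma computable_finite:
  assumes "finite I" "inj_on ei I"
  shows "computable ei eo I f"
  using assms
proof (induction I)
  case empty show ?case by (rule computableI[OF partrec.zero]) simp
next
  case (insert a I)
  then have "computable ei eo I f" by (auto dest: inj_on_subset)
  show ?case
  proof (rule computable_cong[OF computable_if[of ei _ "\<lambda>x. ei x = ei a" eo "\<lambda>_. f a" f]])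
    show "computable ei enc_bool (insert a I) (\<lambda>x. ei x = ei a)"
      by (rule computable_eq_const[OF computable_encode])
    show "computable ei eo {x \<in> insert a I. ei x \<noteq> ei a} f"
      using \<open>computable ei eo I f\<close> by (rule computable_mono) auto
  qed (use insert.prems in \<open>auto intro: computable_const simp: inj_on_def\<close>)
qed

section \<open>Options and lists\<close>

lemma computable_is_None:
  "computable ei (enc_option e) I f \<Longrightarrow> computable ei enc_bool I (\<lambda>x. f x = None)"
  by (rule computable_cong[OF computable_eq_0[OF computable_code]])
    (auto simp: enc_option_def split: option.splits)

text \<open>Returns from numbers to typed values: together with \<open>computable_code\<close> it
  reduces constructors and destructors to arithmetic on codes.\<close>

lemma computable_recode:
  assumes "computable ei id I (\<lambda>x. eo (f x))" shows "computable ei eo I f"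
  using assms by (simp add: computable_def algorithm_def)

lemma computable_the:
  assumes "computable ei (enc_option e) I f" "\<And>x. x \<in> I \<Longrightarrow> f x \<noteq> None"
  shows "computable ei e I (\<lambda>x. the (f x))"
  by (rule computable_recode, rule computable_cong[OF computable_pred[OF computable_code[OF assms(1)]]])
    (use assms(2) in \<open>force simp: enc_option_def split: option.splits\<close>)

text \<open>\<open>list_encode\<close> sends a nonempty list to the successor of the pair of its
  head and the code of its tail, and \<open>[]\<close> to 0. The same fact, read backwards, yields
  head and tail below.\<close>

lemma computable_Cons:
  assumes "computable ei e I f" "computable ei (enc_list e) I g"
  shows "computable ei (enc_list e) I (\<lambda>x. f x # g x)"
  by (rule computable_recode, rule computable_cong[OF computable_Suc[OF
      computable_code[OF computable_Pair[OF assms]]]])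
    (simp add: enc_list_def enc_pair_def)

lemma computable_is_Nil:
  assumes "computable ei (enc_list e) I f"
  shows "computable ei enc_bool I (\<lambda>x. f x = [])"
proof (rule computable_cong[OF computable_eq_0[OF computable_code[OF assms]]])
  fix x show "(f x = []) = (enc_list e (f x) = 0)"
    by (cases "f x") (auto simp: enc_list_def)
qed

lemma computable_hd_tl:
  assumes "computable ei (enc_list e) I f" "\<And>x. x \<in> I \<Longrightarrow> f x \<noteq> []"
  shows "computable ei e I (\<lambda>x. hd (f x))" "computable ei (enc_list e) I (\<lambda>x. tl (f x))"
proof -
  have "computable ei id I (\<lambda>x. enc_pair e (enc_list e) (hd (f x), tl (f x)))"
  proof (rule computable_cong[OF computable_pred[OF computable_code[OF assms(1)]]])
    fix x assume "x \<in> I"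
    then show "enc_pair e (enc_list e) (hd (f x), tl (f x)) = enc_list e (f x) - 1"
      using assms(2) by (cases "f x") (auto simp: enc_list_def enc_pair_def)
  qed
  then have "computable ei (enc_pair e (enc_list e)) I (\<lambda>x. (hd (f x), tl (f x)))"
    by (rule computable_recode)
  from computable_fst'[OF this] computable_snd'[OF this]
  show "computable ei e I (\<lambda>x. hd (f x))" "computable ei (enc_list e) I (\<lambda>x. tl (f x))" by simp_all
qed

section \<open>Iteration and folds\<close>

lemma computable_iterate:
  assumes "computable e e P f" "\<And>p. p \<in> P \<Longrightarrow> f p \<in> P"
  shows "computable (enc_pair e id) e (P \<times> UNIV) (\<lambda>(p, n). (f ^^ n) p)"
proof -
  obtain g where g: "partrec g" "\<And>x. x \<in> P \<Longrightarrow> g (e x) = Some (e (f x))"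
    using assms(1) by (metis computableE)
  have P: "(f ^^ n) p \<in> P" if "p \<in> P" for n p
    by (induction n) (auto simp: that assms(2))
  have *: "rec_nat (Some (e p)) (\<lambda>m r. Option.bind r (\<lambda>i. g i)) n = Some (e ((f ^^ n) p))"
    if "p \<in> P" for n p
    by (induction n) (auto simp: g(2) P that)
  show ?thesis
    by (rule computableI[OF partrec.prec[OF partrec_id partrec.comp[OF g(1)
        partrec.comp[OF partrec.right partrec.right]]]])
      (auto simp: enc_pair_def *)
qed

text \<open>Provides a number of iterations sufficient to consume a list without computing its
  length: the code itself.\<close>

lemma length_le_list_encode: "length xs \<le> list_encode xs"
proof (induction xs)
  case (Cons x xs)
  then show ?case using le_prod_encode_2[of "list_encode xs" x] by simp
qed simp

text \<open>A step consumes one list element and leaves states with an empty list fixed, so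
  iterating it as often as the code of the list says gives the fold: the surplus iterations do
  nothing. The invariant \<open>S\<close> keeps the partial function \<open>f\<close> inside its
  domain.\<close>

lemma computable_foldl:
  assumes f: "computable (enc_pair es ea) es (S \<times> T) (\<lambda>(s, a). f s a)"
    and closed: "\<And>s a. s \<in> S \<Longrightarrow> a \<in> T \<Longrightarrow> f s a \<in> S"
    and g: "computable ei es I g" "\<And>x. x \<in> I \<Longrightarrow> g x \<in> S"
    and h: "computable ei (enc_list ea) I h" "\<And>x. x \<in> I \<Longrightarrow> h x \<in> lists T"
  shows "computable ei es I (\<lambda>x. foldl f (g x) (h x))"
proof -
  define P where "P = S \<times> lists T"
  let ?e = "enc_pair es (enc_list ea)"
  define step where "step = (\<lambda>p. if snd p = [] then p else (f (fst p) (hd (snd p)), tl (snd p)))"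
  have snd: "computable ?e (enc_list ea) J snd" for J by (rule computable_snd)
  have step: "computable ?e ?e P step"
    unfolding step_def
  proof (intro computable_if computable_is_Nil[where e=ea] snd computable_id computable_Pair
      computable_hd_tl[where e=ea])
    have "computable ?e (enc_pair es ea) {x \<in> P. snd x \<noteq> []} (\<lambda>x. (fst x, hd (snd x)))"
      by (intro computable_Pair computable_fst computable_hd_tl snd) auto
    from computable_comp[OF f this]
    show "computable ?e es {x \<in> P. snd x \<noteq> []} (\<lambda>x. f (fst x) (hd (snd x)))"
      by (auto simp: P_def) (smt (verit) Cons_in_lists_iff list.collapse)
  qed auto
  have step_P: "step p \<in> P" if "p \<in> P" for p
    using that by (cases "snd p") (auto simp: step_def P_def closed)
  have iter: "(step ^^ n) (s, xs) = (foldl f s xs, [])" if "length xs \<le> n" for n s xs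
    using that
  proof (induction n arbitrary: s xs)
    case (Suc n)
    show ?case
    proof (cases xs)
      case Nil
      then show ?thesis using Suc.IH[of "[]" s]
        by (simp add: funpow_Suc_right step_def del: funpow.simps)
    next
      case (Cons x ys)
      then show ?thesis using Suc by (simp add: funpow_Suc_right step_def del: funpow.simps)
    qed
  qed simp
  have "computable ei (enc_pair ?e id) I (\<lambda>x. ((g x, h x), enc_list ea (h x)))"
    by (intro computable_Pair g h computable_code)
  from computable_comp[OF computable_iterate[OF step step_P] this]
  have "computable ei ?e I (\<lambda>x. (step ^^ enc_list ea (h x)) (g x, h x))"
    using g h by (simp add: P_def)
  from computable_fst'[OF this]
  show ?thesis
    by (rule computable_cong)
      (metis (no_types) enc_list_def fst_conv iter length_le_list_encode length_map)
qed

lemma computable_rev: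
  assumes "computable ei (enc_list e) I f"
  shows "computable ei (enc_list e) I (\<lambda>x. rev (f x))"
proof -
  have eq: "rev xs = foldl (\<lambda>ys x. x # ys) [] xs" for xs :: "'c list"
  proof -
    have "foldl (\<lambda>ys x. x # ys) zs xs = rev xs @ zs" for zs
      by (induction xs arbitrary: zs) auto
    then show ?thesis by simp
  qed
  have "computable (enc_pair (enc_list e) e) (enc_list e) (UNIV \<times> UNIV) (\<lambda>(s, a). a # s)"
    unfolding split_def by (intro computable_Cons computable_fst computable_snd)
  from computable_foldl[OF this _ computable_const[of ei "enc_list e" _ "[]"] _ assms]
  show ?thesis unfolding eq by simp
qed

lemma computable_foldr:
  assumes f: "computable (enc_pair ea es) es (T \<times> S) (\<lambda>(a, s). f a s)"
    and closed: "\<And>s a. s \<in> S \<Longrightarrow> a \<in> T \<Longrightarrow> f a s \<in> S"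
    and g: "computable ei es I g" "\<And>x. x \<in> I \<Longrightarrow> g x \<in> S"
    and h: "computable ei (enc_list ea) I h" "\<And>x. x \<in> I \<Longrightarrow> h x \<in> lists T"
  shows "computable ei es I (\<lambda>x. foldr f (h x) (g x))"
proof -
  have "computable (enc_pair es ea) es (S \<times> T) (\<lambda>p. f (snd p) (fst p))"
    using computable_comp[OF f computable_Pair[OF computable_snd computable_fst], of "S \<times> T"]
    by auto
  then have "computable (enc_pair es ea) es (S \<times> T) (\<lambda>(s, a). f a s)" by (simp add: split_def)
  from computable_foldl[OF this closed g computable_rev[OF h(1)]] h(2)
  show ?thesis by (simp add: foldr_conv_foldl in_lists_conv_set)
qed

lemma computable_append:
  assumes "computable ei (enc_list e) I f" "computable ei (enc_list e) I g"
  shows "computable ei (enc_list e) I (\<lambda>x. f x @ g x)"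
proof -
  have "computable (enc_pair e (enc_list e)) (enc_list e) (UNIV \<times> UNIV) (\<lambda>(a, s). a # s)"
    unfolding split_def by (intro computable_Cons computable_fst computable_snd)
  from computable_foldr[OF this _ assms(2) _ assms(1)]
  have "computable ei (enc_list e) I (\<lambda>x. foldr (#) (f x) (g x))" by auto
  moreover have "foldr (#) xs ys = xs @ ys" for xs ys :: "'b list" by (induction xs) auto
  ultimately show ?thesis by simp
qed

section \<open>The action of the factors on normal forms\<close>

text \<open>A and B form one family indexed by \<open>factor\<close>, so every statement about a
  factor is proved once. C stays a separate abstract group because its elements travel between the
  factors.\<close>

locale amalgam_data =
  fixes F :: "factor \<Rightarrow> 'a monoid" and C :: "'c monoid" and emb :: "factor \<Rightarrow> 'c \<Rightarrow> 'a"
  assumes group_F: "group (F H)" and group_C: "group C" and emb_mon: "emb H \<in> mon C (F H)"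
begin

sublocale F: group "F H" for H by (rule group_F)
sublocale C: group C by (rule group_C)
sublocale emb: group_hom C "F H" "emb H" for H
  by unfold_locales (use emb_mon in \<open>auto simp: mon_def\<close>)

abbreviation im :: "factor \<Rightarrow> 'a set" where "im H \<equiv> emb H ` carrier C"

lemma emb_eq_iff [simp]: "c \<in> carrier C \<Longrightarrow> d \<in> carrier C \<Longrightarrow> emb H c = emb H d \<longleftrightarrow> c = d"
  using emb_mon[of H] by (auto simp: mon_def inj_on_def)

lemma subgroup_im: "subgroup (im H) (F H)"
  by (rule emb.img_is_subgroup)

lemma mult_im_left: "c \<in> carrier C \<Longrightarrow> a \<in> carrier (F H) \<Longrightarrow> emb H c \<otimes>\<^bsub>F H\<^esub> a \<in> im H \<longleftrightarrow> a \<in> im H"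
proof -
  assume c: "c \<in> carrier C" and a: "a \<in> carrier (F H)"
  interpret subgroup "im H" "F H" by (rule subgroup_im)
  have "a = inv\<^bsub>F H\<^esub> (emb H c) \<otimes>\<^bsub>F H\<^esub> (emb H c \<otimes>\<^bsub>F H\<^esub> a)"
    using c a by (simp add: F.m_assoc[symmetric])
  then show ?thesis using c by (metis imageI m_closed m_inv_closed)
qed

lemma mult_im_right: "c \<in> carrier C \<Longrightarrow> a \<in> carrier (F H) \<Longrightarrow> a \<otimes>\<^bsub>F H\<^esub> emb H c \<in> im H \<longleftrightarrow> a \<in> im H"
proof -
  assume c: "c \<in> carrier C" and a: "a \<in> carrier (F H)"
  interpret subgroup "im H" "F H" by (rule subgroup_im)
  have "a = (a \<otimes>\<^bsub>F H\<^esub> emb H c) \<otimes>\<^bsub>F H\<^esub> inv\<^bsub>F H\<^esub> (emb H c)"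
    using c a by (simp add: F.m_assoc)
  then show ?thesis using c by (metis imageI m_closed m_inv_closed)
qed

definition reduced :: "(factor \<times> 'a) list \<Rightarrow> bool" where
  "reduced ts \<longleftrightarrow> successively (\<lambda>s t. fst s \<noteq> fst t) ts \<and>
     (\<forall>(H, t) \<in> set ts. t \<in> carrier (F H) - im H)"

abbreviation starts :: "factor \<Rightarrow> (factor \<times> 'a) list \<Rightarrow> bool" where
  "starts H ts \<equiv> ts \<noteq> [] \<and> fst (hd ts) = H"

lemma reduced_Nil [simp]: "reduced []"
  by (simp add: reduced_def)

lemma reduced_Cons:
  "reduced ((H, a) # ts) \<longleftrightarrow> a \<in> carrier (F H) - im H \<and> reduced ts \<and> \<not> starts H ts"
  by (cases ts) (auto simp: reduced_def)

section \<open>Right coset representatives of C and the C-part of an element\<close>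

definition rep :: "factor \<Rightarrow> 'a \<Rightarrow> 'a" where
  "rep H a = (if a \<in> im H then \<one>\<^bsub>F H\<^esub> else SOME t. t \<in> im H #>\<^bsub>F H\<^esub> a)"

definition cpart :: "factor \<Rightarrow> 'a \<Rightarrow> 'c" where
  "cpart H a = (THE c. c \<in> carrier C \<and> emb H c \<otimes>\<^bsub>F H\<^esub> rep H a = a)"

lemma rep_coset:
  assumes "a \<in> carrier (F H)"
  obtains c where "c \<in> carrier C" "rep H a = emb H c \<otimes>\<^bsub>F H\<^esub> a"
proof (cases "a \<in> im H")
  case True
  then obtain c where "c \<in> carrier C" "a = emb H c" by auto
  then show thesis using that[of "inv\<^bsub>C\<^esub> c"] True by (auto simp: rep_def)
next
  case False
  have "rep H a \<in> im H #>\<^bsub>F H\<^esub> a"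
    using False F.rcos_self[OF assms subgroup_im] by (simp add: rep_def) (rule someI)
  then show thesis using that by (auto simp: r_coset_def)
qed

lemma rep_closed [simp]: "a \<in> carrier (F H) \<Longrightarrow> rep H a \<in> carrier (F H)"
  by (metis F.m_closed emb.hom_closed rep_coset)

lemma rep_in_im_iff: "a \<in> carrier (F H) \<Longrightarrow> rep H a \<in> im H \<longleftrightarrow> a \<in> im H"
  by (metis mult_im_left rep_coset)

lemma rep_mult:
  assumes "c \<in> carrier C" "a \<in> carrier (F H)"
  shows "rep H (emb H c \<otimes>\<^bsub>F H\<^esub> a) = rep H a"
proof -
  have "im H #>\<^bsub>F H\<^esub> (emb H c \<otimes>\<^bsub>F H\<^esub> a) = im H #>\<^bsub>F H\<^esub> a"
    using F.repr_independence[of "emb H c \<otimes>\<^bsub>F H\<^esub> a" H "im H" a] assms subgroup_im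
    by (auto simp: r_coset_def)
  then show ?thesis using mult_im_left[OF assms] by (simp add: rep_def)
qed

lemma rep_rep [simp]: "a \<in> carrier (F H) \<Longrightarrow> rep H (rep H a) = rep H a"
  by (metis rep_coset rep_mult)

lemma cpart_eqI:
  assumes "c \<in> carrier C" "a \<in> carrier (F H)" "emb H c \<otimes>\<^bsub>F H\<^esub> rep H a = a"
  shows "cpart H a = c"
  unfolding cpart_def
proof (rule the_equality)
  fix d assume d: "d \<in> carrier C \<and> emb H d \<otimes>\<^bsub>F H\<^esub> rep H a = a"
  then have "emb H d \<otimes>\<^bsub>F H\<^esub> rep H a = emb H c \<otimes>\<^bsub>F H\<^esub> rep H a" using assms by simp
  then have "emb H d = emb H c"
    using F.right_cancel[of "rep H a" H "emb H d" "emb H c"] d assms(1,2) by simp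
  then show "d = c" using d assms(1) by simp
qed (use assms in simp)

lemma cpart:
  assumes "a \<in> carrier (F H)"
  shows "cpart H a \<in> carrier C" "emb H (cpart H a) \<otimes>\<^bsub>F H\<^esub> rep H a = a"
proof -
  obtain c where c: "c \<in> carrier C" "rep H a = emb H c \<otimes>\<^bsub>F H\<^esub> a" using rep_coset assms by blast
  then have "emb H (inv\<^bsub>C\<^esub> c) \<otimes>\<^bsub>F H\<^esub> rep H a = a"
    using assms by (simp add: F.m_assoc[symmetric])
  then show "cpart H a \<in> carrier C" "emb H (cpart H a) \<otimes>\<^bsub>F H\<^esub> rep H a = a"
    using cpart_eqI[of "inv\<^bsub>C\<^esub> c" a H] c assms by auto
qed

lemma cpart_mult:
  assumes "c \<in> carrier C" "a \<in> carrier (F H)"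
  shows "cpart H (emb H c \<otimes>\<^bsub>F H\<^esub> a) = c \<otimes>\<^bsub>C\<^esub> cpart H a"
  by (rule cpart_eqI) (use assms cpart[OF assms(2)] in \<open>auto simp: rep_mult F.m_assoc\<close>)

lemma cpart_rep: "a \<in> carrier (F H) \<Longrightarrow> cpart H (rep H a) = \<one>\<^bsub>C\<^esub>"
  by (rule cpart_eqI) auto

lemma cpart_emb: "c \<in> carrier C \<Longrightarrow> cpart H (emb H c) = c"
  by (rule cpart_eqI) (auto simp: rep_def)

section \<open>Normal forms and the action of a factor\<close>

definition Omega :: "('c \<times> (factor \<times> 'a) list) set" where
  "Omega = {(c, ts). c \<in> carrier C \<and> reduced ts \<and> (\<forall>(H, t) \<in> set ts. rep H t = t)}"

text \<open>A member \<open>(c, [t_1, ..., t_n])\<close> of \<open>Omega\<close> stands for c t_1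
  ... t_n with coset representatives t_i; here the C-part is on the left.
  \<open>split_head H\<close> collects c and a leading syllable from \<open>H\<close> into one
  element of \<open>F H\<close>, and \<open>join_head H\<close> takes it apart again. They are
  inverse bijections between \<open>Omega\<close> and \<open>heads H\<close>.\<close>

fun split_head :: "factor \<Rightarrow> 'c \<times> (factor \<times> 'a) list \<Rightarrow> 'a \<times> (factor \<times> 'a) list" where
  "split_head H (c, []) = (emb H c, [])"
| "split_head H (c, (K, t) # ts) =
     (if K = H then (emb H c \<otimes>\<^bsub>F H\<^esub> t, ts) else (emb H c, (K, t) # ts))"

definition join_head :: "factor \<Rightarrow> 'a \<times> (factor \<times> 'a) list \<Rightarrow> 'c \<times> (factor \<times> 'a) list" where
  "join_head H = (\<lambda>(a, ts). (cpart H a, if a \<in> im H then ts else (H, rep H a) # ts))"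

text \<open>Left multiplication in \<open>F H\<close>, transported along the bijection with
  \<open>heads H\<close>; the laws of an action are inherited from associativity in
  \<open>F H\<close>.\<close>

definition act :: "factor \<Rightarrow> 'a \<Rightarrow> 'c \<times> (factor \<times> 'a) list \<Rightarrow> 'c \<times> (factor \<times> 'a) list" where
  "act H a p = (let (b, ts) = split_head H p in join_head H (a \<otimes>\<^bsub>F H\<^esub> b, ts))"

definition heads :: "factor \<Rightarrow> ('a \<times> (factor \<times> 'a) list) set" where
  "heads H = {(a, ts). a \<in> carrier (F H) \<and> (\<one>\<^bsub>C\<^esub>, ts) \<in> Omega \<and> \<not> starts H ts}"

lemma split_head: "p \<in> Omega \<Longrightarrow> split_head H p \<in> heads H"
  by (induction H p rule: split_head.induct)
    (auto simp: Omega_def heads_def reduced_Cons)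

lemma join_head: "q \<in> heads H \<Longrightarrow> join_head H q \<in> Omega"
  by (auto simp: Omega_def heads_def join_head_def reduced_Cons cpart rep_in_im_iff split: if_splits)

lemma join_split:
  assumes "p \<in> Omega"
  shows "join_head H (split_head H p) = p"
proof -
  have *: "cpart H (emb H c \<otimes>\<^bsub>F H\<^esub> t) = c" "\<forall>d \<in> carrier C. emb H c \<otimes>\<^bsub>F H\<^esub> t \<noteq> emb H d" "rep H (emb H c \<otimes>\<^bsub>F H\<^esub> t) = t"
    if "c \<in> carrier C" "t \<in> carrier (F H)" "t \<notin> im H" "rep H t = t" for c t
    using that cpart_rep[of t H] mult_im_left[of c t H]
    by (auto simp: cpart_mult rep_mult image_iff)
  obtain c ts where "p = (c, ts)" by (cases p)
  then show ?thesis using assms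
    by (cases ts) (auto simp: Omega_def join_head_def reduced_Cons cpart_emb * image_iff)
qed

lemma split_join:
  assumes "q \<in> heads H" shows "split_head H (join_head H q) = q"
proof -
  obtain a ts where q: "q = (a, ts)" by (cases q)
  show ?thesis using assms cpart[of a H]
    by (cases ts) (auto simp: q heads_def join_head_def cpart_emb)
qed

lemma act_closed:
  assumes "a \<in> carrier (F H)" "p \<in> Omega"
  shows "act H a p \<in> Omega"
proof -
  obtain b ts where "split_head H p = (b, ts)" by (cases "split_head H p")
  with split_head[OF assms(2), of H] show ?thesis
    by (auto simp: act_def heads_def assms intro!: join_head)
qed

lemma act_mult:
  assumes "a \<in> carrier (F H)" "b \<in> carrier (F H)" "p \<in> Omega"
  shows "act H (a \<otimes>\<^bsub>F H\<^esub> b) p = act H a (act H b p)"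
proof -
  obtain d ts where *: "split_head H p = (d, ts)" by (cases "split_head H p")
  with split_head[OF assms(3), of H] have "(b \<otimes>\<^bsub>F H\<^esub> d, ts) \<in> heads H" "d \<in> carrier (F H)"
    by (auto simp: heads_def assms)
  then show ?thesis using assms by (simp add: act_def * split_join F.m_assoc)
qed

lemma act_one: "p \<in> Omega \<Longrightarrow> act H \<one>\<^bsub>F H\<^esub> p = p"
  using split_head[of p H] join_split[of p H] by (auto simp: act_def heads_def split: prod.splits)

text \<open>The result does not mention \<open>H\<close>: an element of C acts in the same way
  through either factor. This is what makes the relators that identify the two copies of C act
  trivially.\<close>

lemma act_emb:
  assumes "d \<in> carrier C" "(c, ts) \<in> Omega"
  shows "act H (emb H d) (c, ts) = (d \<otimes>\<^bsub>C\<^esub> c, ts)"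
proof -
  have "(d \<otimes>\<^bsub>C\<^esub> c, ts) \<in> Omega" using assms by (auto simp: Omega_def)
  moreover have "split_head H (d \<otimes>\<^bsub>C\<^esub> c, ts) =
     (case split_head H (c, ts) of (b, us) \<Rightarrow> (emb H d \<otimes>\<^bsub>F H\<^esub> b, us))"
    using assms by (cases ts) (auto simp: Omega_def reduced_Cons F.m_assoc)
  ultimately show ?thesis using join_split[of "(d \<otimes>\<^bsub>C\<^esub> c, ts)" H]
    by (simp add: act_def split_def)
qed

lemma act_prepend:
  assumes "a \<in> carrier (F H) - im H" "(c, ts) \<in> Omega" "\<not> starts H ts"
  obtains d t where "act H a (c, ts) = (d, (H, t) # ts)"
proof -
  have "split_head H (c, ts) = (emb H c, ts)"
    using assms(3) by (cases ts) auto
  moreover have "a \<otimes>\<^bsub>F H\<^esub> emb H c \<notin> im H"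
    using assms by (auto simp: Omega_def mult_im_right)
  ultimately show thesis using that by (simp add: act_def join_head_def)
qed

text \<open>Each syllable meets a form headed by the other factor, hence adds exactly one syllable
  by \<open>act_prepend\<close>. So the number of syllables of a reduced product can be read off
  from its effect on \<open>(c, [])\<close>.\<close>

lemma act_reduced:
  assumes "reduced ss" "c \<in> carrier C"
  obtains d ts where "foldr (\<lambda>(H, a). act H a) ss (c, []) = (d, ts)" "(d, ts) \<in> Omega"
    "map fst ts = map fst ss"
proof -
  have "\<exists>d ts. foldr (\<lambda>(H, a). act H a) ss (c, []) = (d, ts) \<and> (d, ts) \<in> Omega \<and> map fst ts = map fst ss"
    using assms(1)
  proof (induction ss)
    case Nil then show ?case using assms(2) by (auto simp: Omega_def)
  next
    case (Cons s ss)
    obtain H a where s: "s = (H, a)" by (cases s)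
    obtain d ts where IH: "foldr (\<lambda>(H, a). act H a) ss (c, []) = (d, ts)" "(d, ts) \<in> Omega"
      "map fst ts = map fst ss" using Cons by (auto simp: s reduced_Cons)
    have "\<not> starts H ts" using Cons.prems IH(3) by (cases ss) (auto simp: s reduced_Cons)
    moreover have a: "a \<in> carrier (F H) - im H" using Cons.prems by (simp add: s reduced_Cons)
    ultimately obtain d' t where "act H a (d, ts) = (d', (H, t) # ts)"
      using act_prepend IH(2) by metis
    then show ?case using act_closed[of a H "(d, ts)"] a IH by (auto simp: s)
  qed
  then show thesis using that by blast
qed

end

section \<open>Conjugation in an amalgamated product\<close>

context group begin

text \<open>The equation x h = h y contains no inverse and passes directly through homomorphisms.
  Nontriviality may be asked of x instead of the conjugate y, since x and y are trivial
  together.\<close>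

lemma Nstar_iff:
  assumes "subgroup K G"
  shows "h \<in> Nstar G K \<longleftrightarrow> h \<in> carrier G \<and> (\<exists>x\<in>K. \<exists>y\<in>K. x \<noteq> \<one> \<and> x \<otimes> h = h \<otimes> y)"
proof -
  interpret K: subgroup K G by fact
  have conj: "inv h \<otimes> x \<otimes> h = y \<longleftrightarrow> x \<otimes> h = h \<otimes> y"
    if "h \<in> carrier G" "x \<in> K" "y \<in> carrier G" for x y
    using that by (metis K.mem_carrier inv_solve_left m_assoc m_closed inv_closed)
  have "\<one> \<in> K \<inter> conj_set G K h" if "h \<in> carrier G"
    unfolding conj_set_def using that by (auto intro!: exI[of _ "\<one>"])
  then have "h \<in> Nstar G K \<longleftrightarrow> h \<in> carrier G \<and> (\<exists>y\<in>K \<inter> conj_set G K h. y \<noteq> \<one>)"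
    by (auto simp: Nstar_def)
  also have "\<dots> \<longleftrightarrow> h \<in> carrier G \<and> (\<exists>x\<in>K. \<exists>y\<in>K. y \<noteq> \<one> \<and> x \<otimes> h = h \<otimes> y)"
  proof -
    have "y \<in> conj_set G K h \<longleftrightarrow> (\<exists>x\<in>K. x \<otimes> h = h \<otimes> y)" if "h \<in> carrier G" "y \<in> K" for y
      unfolding conj_set_def using conj[OF that(1) _ K.mem_carrier[OF that(2)]] by auto
    then show ?thesis by blast
  qed
  also have "\<dots> \<longleftrightarrow> h \<in> carrier G \<and> (\<exists>x\<in>K. \<exists>y\<in>K. x \<noteq> \<one> \<and> x \<otimes> h = h \<otimes> y)"
  proof -
    have "x = \<one> \<longleftrightarrow> y = \<one>" if "h \<in> carrier G" "x \<in> K" "y \<in> K" "x \<otimes> h = h \<otimes> y" for x y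
      using that by (metis K.mem_carrier l_cancel_one' r_cancel_one')
    then show ?thesis by blast
  qed
  finally show ?thesis .
qed

lemma Zset_iff:
  assumes "subgroup K G"
  shows "x \<in> Zset G K \<longleftrightarrow> x \<in> K \<and> (\<exists>h \<in> Nstar G K - K. \<exists>y\<in>K. x \<otimes> h = h \<otimes> y)"
proof -
  interpret K: subgroup K G by fact
  have "x = inv (inv h) \<otimes> y \<otimes> inv h \<longleftrightarrow> x \<otimes> h = h \<otimes> y"
    if "h \<in> Nstar G K" "x \<in> K" "y \<in> K" for h y
  proof -
    have "h \<in> carrier G" using that(1) by (simp add: Nstar_def)
    then show ?thesis using that by (metis K.mem_carrier inv_inv inv_solve_right m_closed)
  qed
  then show ?thesis unfolding Zset_def conj_set_def by blast
qed

end

section \<open>Groups receiving both factors, and products of syllables\<close>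

locale amalgam_cone = amalgam_data F C emb + G: group G
  for F :: "factor \<Rightarrow> 'a monoid" and C :: "'c monoid" and emb and G :: "'g monoid" +
  fixes inc :: "factor \<Rightarrow> 'a \<Rightarrow> 'g"
  assumes inc_hom: "inc H \<in> hom (F H) G"
    and inc_emb_eq: "c \<in> carrier C \<Longrightarrow> inc H (emb H c) = inc K (emb K c)"
begin

sublocale inc: group_hom "F H" G "inc H" for H
  by unfold_locales (rule inc_hom)

definition inc_C :: "'c \<Rightarrow> 'g" where
  "inc_C c = inc FactorA (emb FactorA c)"

lemma inc_emb: "c \<in> carrier C \<Longrightarrow> inc H (emb H c) = inc_C c"
  unfolding inc_C_def by (rule inc_emb_eq)

sublocale inc_C: group_hom C G inc_C
  by unfold_locales (auto simp: inc_C_def hom_def)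

definition prod_syllables :: "(factor \<times> 'a) list \<Rightarrow> 'g" where
  "prod_syllables ss = foldr (\<lambda>(H, a) g. inc H a \<otimes>\<^bsub>G\<^esub> g) ss \<one>\<^bsub>G\<^esub>"

lemma prod_syllables_simps [simp]:
  "prod_syllables [] = \<one>\<^bsub>G\<^esub>"
  "prod_syllables ((H, a) # ss) = inc H a \<otimes>\<^bsub>G\<^esub> prod_syllables ss"
  by (simp_all add: prod_syllables_def)

lemma prod_syllables_closed: "reduced ss \<Longrightarrow> prod_syllables ss \<in> carrier G"
proof (induction ss)
  case (Cons s ss)
  then show ?case by (cases s) (auto simp: reduced_Cons)
qed simp

abbreviation CG :: "'g set" where "CG \<equiv> inc_C ` carrier C"

text \<open>For reduced lists this is the intersection of C with g C g^-1, where g is the product of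
  the syllables (\<open>core_eq\<close>). The last syllable conjugates first.\<close>

fun core :: "(factor \<times> 'a) list \<Rightarrow> 'c set" where
  "core [] = carrier C"
| "core ((H, a) # ss) =
     {c \<in> carrier C. \<exists>k \<in> core ss. emb H c = a \<otimes>\<^bsub>F H\<^esub> emb H k \<otimes>\<^bsub>F H\<^esub> inv\<^bsub>F H\<^esub> a}"

end

text \<open>Collects what the conjugation argument takes from the normal form theorem: the syllable
  count is an invariant of the element, C embeds, and reduced products exhaust G.\<close>

locale amalgam = amalgam_cone F C emb G inc
  for F :: "factor \<Rightarrow> 'a monoid" and C :: "'c monoid" and emb and G :: "'g monoid" and inc +
  assumes length_unique: "\<lbrakk>reduced ss; reduced ts; c \<in> carrier C; d \<in> carrier C;
      prod_syllables ss \<otimes>\<^bsub>G\<^esub> inc_C c = prod_syllables ts \<otimes>\<^bsub>G\<^esub> inc_C d\<rbrakk> \<Longrightarrow> length ss = length ts"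
    and inc_C_inj: "\<lbrakk>c \<in> carrier C; inc_C c = \<one>\<^bsub>G\<^esub>\<rbrakk> \<Longrightarrow> c = \<one>\<^bsub>C\<^esub>"
    and spanning: "g \<in> carrier G \<Longrightarrow>
      \<exists>ss c. reduced ss \<and> c \<in> carrier C \<and> g = prod_syllables ss \<otimes>\<^bsub>G\<^esub> inc_C c"
begin

lemma subgroup_CG: "subgroup CG G"
  by (rule inc_C.img_is_subgroup)

lemma prod_syllables_in_CG_iff:
  assumes "reduced ss" "c \<in> carrier C"
  shows "prod_syllables ss \<otimes>\<^bsub>G\<^esub> inc_C c \<in> CG \<longleftrightarrow> ss = []"
proof
  assume "prod_syllables ss \<otimes>\<^bsub>G\<^esub> inc_C c \<in> CG"
  then obtain d where "d \<in> carrier C" "prod_syllables ss \<otimes>\<^bsub>G\<^esub> inc_C c = prod_syllables [] \<otimes>\<^bsub>G\<^esub> inc_C d"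
    by auto
  then show "ss = []" using length_unique[OF assms(1) reduced_Nil assms(2)] by simp
qed (use assms in auto)

text \<open>Let c a g = a g k' with first syllable a. Then b = a^-1 c a, an element of the factor of
  a, satisfies b g = g k'. Counting syllables forces b into C, so b belongs to the core of g and c
  arises from it by one step.\<close>

lemma core_eq:
  assumes "reduced ss"
  shows "core ss = {c \<in> carrier C. \<exists>k \<in> carrier C.
           inc_C c \<otimes>\<^bsub>G\<^esub> prod_syllables ss = prod_syllables ss \<otimes>\<^bsub>G\<^esub> inc_C k}"
  using assms
proof (induction ss)
  case Nil show ?case by auto
next
  case (Cons s ss)
  obtain H a where s [simp]: "s = (H, a)" by (cases s)
  let ?g = "prod_syllables ss"
  have a: "a \<in> carrier (F H)" "a \<notin> im H" and ss: "reduced ss" "\<not> starts H ss"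
    using Cons.prems by (auto simp: reduced_Cons)
  have g: "?g \<in> carrier G" by (rule prod_syllables_closed[OF ss(1)])
  note IH = Cons.IH[OF ss(1)]
  have conj: "emb H c = a \<otimes>\<^bsub>F H\<^esub> b \<otimes>\<^bsub>F H\<^esub> inv\<^bsub>F H\<^esub> a \<longleftrightarrow> emb H c \<otimes>\<^bsub>F H\<^esub> a = a \<otimes>\<^bsub>F H\<^esub> b"
    if "c \<in> carrier C" "b \<in> carrier (F H)" for c b
    using that a by (metis F.inv_solve_right F.m_closed emb.hom_closed)
  have push: "inc_C c \<otimes>\<^bsub>G\<^esub> (inc H a \<otimes>\<^bsub>G\<^esub> ?g) = inc H a \<otimes>\<^bsub>G\<^esub> (inc H b \<otimes>\<^bsub>G\<^esub> ?g)"
    if "c \<in> carrier C" "b \<in> carrier (F H)" "emb H c \<otimes>\<^bsub>F H\<^esub> a = a \<otimes>\<^bsub>F H\<^esub> b" for c b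
  proof -
    have "inc H (emb H c) \<otimes>\<^bsub>G\<^esub> inc H a = inc H a \<otimes>\<^bsub>G\<^esub> inc H b"
      using that a by (metis inc.hom_mult emb.hom_closed)
    then show ?thesis using that a g by (simp add: inc_emb G.m_assoc[symmetric])
  qed
  show ?case
  proof (intro equalityI subsetI)
    fix c assume "c \<in> core (s # ss)"
    then have "c \<in> carrier C" "\<exists>k \<in> core ss. emb H c = a \<otimes>\<^bsub>F H\<^esub> emb H k \<otimes>\<^bsub>F H\<^esub> inv\<^bsub>F H\<^esub> a"
      by simp_all
    then obtain k where c: "c \<in> carrier C" "k \<in> core ss"
      "emb H c = a \<otimes>\<^bsub>F H\<^esub> emb H k \<otimes>\<^bsub>F H\<^esub> inv\<^bsub>F H\<^esub> a" by blast
    with IH obtain k' where k: "k \<in> carrier C" "k' \<in> carrier C"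
      "inc_C k \<otimes>\<^bsub>G\<^esub> ?g = ?g \<otimes>\<^bsub>G\<^esub> inc_C k'" by auto
    have "emb H c \<otimes>\<^bsub>F H\<^esub> a = a \<otimes>\<^bsub>F H\<^esub> emb H k"
      using conj[of c "emb H k"] c k(1) by simp
    from push[OF c(1) _ this] k a g have "inc_C c \<otimes>\<^bsub>G\<^esub> (inc H a \<otimes>\<^bsub>G\<^esub> ?g)
       = inc H a \<otimes>\<^bsub>G\<^esub> ?g \<otimes>\<^bsub>G\<^esub> inc_C k'" by (simp add: inc_emb G.m_assoc)
    then show "c \<in> {c \<in> carrier C. \<exists>k \<in> carrier C.
           inc_C c \<otimes>\<^bsub>G\<^esub> prod_syllables (s # ss) = prod_syllables (s # ss) \<otimes>\<^bsub>G\<^esub> inc_C k}"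
      using c(1) k(2) by auto
  next
    fix c assume "c \<in> {c \<in> carrier C. \<exists>k \<in> carrier C.
           inc_C c \<otimes>\<^bsub>G\<^esub> prod_syllables (s # ss) = prod_syllables (s # ss) \<otimes>\<^bsub>G\<^esub> inc_C k}"
    then obtain k' where c: "c \<in> carrier C" "k' \<in> carrier C"
      "inc_C c \<otimes>\<^bsub>G\<^esub> (inc H a \<otimes>\<^bsub>G\<^esub> ?g) = inc H a \<otimes>\<^bsub>G\<^esub> ?g \<otimes>\<^bsub>G\<^esub> inc_C k'" by auto
    define b where "b = inv\<^bsub>F H\<^esub> a \<otimes>\<^bsub>F H\<^esub> (emb H c \<otimes>\<^bsub>F H\<^esub> a)"
    have b: "b \<in> carrier (F H)" "emb H c \<otimes>\<^bsub>F H\<^esub> a = a \<otimes>\<^bsub>F H\<^esub> b"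
      using a c(1) by (auto simp: b_def F.m_assoc[symmetric])
    from push[OF c(1) b] c a g b have "inc H a \<otimes>\<^bsub>G\<^esub> (inc H b \<otimes>\<^bsub>G\<^esub> ?g) = inc H a \<otimes>\<^bsub>G\<^esub> (?g \<otimes>\<^bsub>G\<^esub> inc_C k')"
      by (simp add: G.m_assoc)
    then have bg: "inc H b \<otimes>\<^bsub>G\<^esub> ?g = ?g \<otimes>\<^bsub>G\<^esub> inc_C k'"
      using a b g c by simp
    \<comment> \<open>Since \<open>ss\<close> does not start with \<open>H\<close>, a syllable
      \<open>b\<close> outside C could be put in front of it, giving a reduced product with one
      syllable more; but by \<open>bg\<close> its value is that of \<open>ss\<close> times an
      element of C.\<close>
    have "b \<in> im H"
    proof (rule ccontr)
      assume "b \<notin> im H"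
      then have "reduced ((H, b) # ss)" using b ss by (simp add: reduced_Cons)
      from length_unique[OF this ss(1) C.one_closed c(2)] bg b(1) g c(2) show False by simp
    qed
    then obtain k where k: "k \<in> carrier C" "b = emb H k" by auto
    then have "k \<in> core ss" using IH bg c(2) by (auto simp: inc_emb)
    then show "c \<in> core (s # ss)" using conj[OF c(1) b(1)] b k c(1) by auto
  qed
qed

text \<open>A factor d from C at the end changes only the witness: k is replaced by d k d^-1, and
  this runs through all of C when k does.\<close>

lemma core_eq':
  assumes "reduced ss" "d \<in> carrier C"
  shows "core ss = {c \<in> carrier C. \<exists>k \<in> carrier C. inc_C c \<otimes>\<^bsub>G\<^esub> (prod_syllables ss \<otimes>\<^bsub>G\<^esub> inc_C d)
           = prod_syllables ss \<otimes>\<^bsub>G\<^esub> inc_C d \<otimes>\<^bsub>G\<^esub> inc_C k}"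
proof -
  let ?g = "prod_syllables ss"
  have g: "?g \<in> carrier G" by (rule prod_syllables_closed[OF assms(1)])
  have 1: "inc_C c \<otimes>\<^bsub>G\<^esub> (?g \<otimes>\<^bsub>G\<^esub> inc_C d) = ?g \<otimes>\<^bsub>G\<^esub> inc_C d \<otimes>\<^bsub>G\<^esub> inc_C k \<longleftrightarrow>
     inc_C c \<otimes>\<^bsub>G\<^esub> ?g = ?g \<otimes>\<^bsub>G\<^esub> inc_C (d \<otimes>\<^bsub>C\<^esub> k \<otimes>\<^bsub>C\<^esub> inv\<^bsub>C\<^esub> d)"
    if "c \<in> carrier C" "k \<in> carrier C" for c k
  proof -
    have "?g \<otimes>\<^bsub>G\<^esub> inc_C d \<otimes>\<^bsub>G\<^esub> inc_C k = ?g \<otimes>\<^bsub>G\<^esub> inc_C (d \<otimes>\<^bsub>C\<^esub> k \<otimes>\<^bsub>C\<^esub> inv\<^bsub>C\<^esub> d) \<otimes>\<^bsub>G\<^esub> inc_C d"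
      using that assms(2) g by (simp add: G.m_assoc flip: inc_C.hom_mult)
        (simp add: C.m_assoc)
    moreover have "inc_C c \<otimes>\<^bsub>G\<^esub> (?g \<otimes>\<^bsub>G\<^esub> inc_C d) = inc_C c \<otimes>\<^bsub>G\<^esub> ?g \<otimes>\<^bsub>G\<^esub> inc_C d"
      using that assms(2) g by (simp add: G.m_assoc)
    ultimately show ?thesis using that assms(2) g by simp
  qed
  have 2: "k = d \<otimes>\<^bsub>C\<^esub> (inv\<^bsub>C\<^esub> d \<otimes>\<^bsub>C\<^esub> k \<otimes>\<^bsub>C\<^esub> d) \<otimes>\<^bsub>C\<^esub> inv\<^bsub>C\<^esub> d" if "k \<in> carrier C" for k
    using that assms(2) by (simp add: C.m_assoc) (simp add: C.m_assoc[symmetric])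
  show ?thesis
  proof -
    have "(\<exists>k \<in> carrier C. inc_C c \<otimes>\<^bsub>G\<^esub> ?g = ?g \<otimes>\<^bsub>G\<^esub> inc_C k) \<longleftrightarrow>
      (\<exists>k \<in> carrier C. inc_C c \<otimes>\<^bsub>G\<^esub> ?g = ?g \<otimes>\<^bsub>G\<^esub> inc_C (d \<otimes>\<^bsub>C\<^esub> k \<otimes>\<^bsub>C\<^esub> inv\<^bsub>C\<^esub> d))" for c
      using 2 assms(2) by (metis C.inv_closed C.m_closed)
    then show ?thesis using 1 unfolding core_eq[OF assms(1)] by (auto 0 4)
  qed
qed

lemma one_in_core: "reduced ss \<Longrightarrow> \<one>\<^bsub>C\<^esub> \<in> core ss"
  using prod_syllables_closed by (auto simp: core_eq intro!: bexI[of _ "\<one>\<^bsub>C\<^esub>"])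

lemma inc_C_eq_one_iff: "c \<in> carrier C \<Longrightarrow> inc_C c = \<one>\<^bsub>G\<^esub> \<longleftrightarrow> c = \<one>\<^bsub>C\<^esub>"
  using inc_C_inj by auto

lemma Nstar_iff_core:
  assumes "reduced ss" "d \<in> carrier C"
  shows "prod_syllables ss \<otimes>\<^bsub>G\<^esub> inc_C d \<in> Nstar G CG \<longleftrightarrow> core ss \<noteq> {\<one>\<^bsub>C\<^esub>}"
proof -
  have "core ss \<noteq> {\<one>\<^bsub>C\<^esub>} \<longleftrightarrow> (\<exists>c \<in> core ss. c \<noteq> \<one>\<^bsub>C\<^esub>)"
    using one_in_core[OF assms(1)] by auto
  then show ?thesis
    unfolding G.Nstar_iff[OF subgroup_CG] core_eq'[OF assms]
    using prod_syllables_closed[OF assms(1)] assms(2) by (auto simp: inc_C_eq_one_iff)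
qed

text \<open>The conjugating element h lies outside C, so it has a first syllable a. Whatever h
  conjugates into C is conjugated into C by a already. Applied to c and to a nontrivial witness for
  h, this gives both halves of membership in the set of the factor. Conversely a one-syllable
  product lies outside C, so witnesses in a factor remain witnesses in G.\<close>

lemma Zset_iff_factors:
  assumes c: "c \<in> carrier C"
  shows "inc_C c \<in> Zset G CG \<longleftrightarrow> (\<exists>H. emb H c \<in> Zset (F H) (im H))"
proof
  assume "inc_C c \<in> Zset G CG"
  then obtain h y where h: "h \<in> Nstar G CG" "h \<notin> CG" "y \<in> CG" "inc_C c \<otimes>\<^bsub>G\<^esub> h = h \<otimes>\<^bsub>G\<^esub> y"
    unfolding G.Zset_iff[OF subgroup_CG] by auto
  then have "h \<in> carrier G" by (simp add: Nstar_def)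
  then obtain ss d where ss: "reduced ss" "d \<in> carrier C" "h = prod_syllables ss \<otimes>\<^bsub>G\<^esub> inc_C d"
    using spanning by blast
  then have "ss \<noteq> []" using h(2) by (simp add: prod_syllables_in_CG_iff)
  then obtain H a us where us: "ss = (H, a) # us" by (metis list.exhaust surj_pair)
  have a: "a \<in> carrier (F H)" "a \<notin> im H" using ss(1) by (auto simp: us reduced_Cons)
  have commute: "\<exists>k \<in> carrier C. emb H x \<otimes>\<^bsub>F H\<^esub> a = a \<otimes>\<^bsub>F H\<^esub> emb H k" if "x \<in> core ss" for x
  proof -
    have "x \<in> carrier C" "\<exists>k \<in> core us. emb H x = a \<otimes>\<^bsub>F H\<^esub> emb H k \<otimes>\<^bsub>F H\<^esub> inv\<^bsub>F H\<^esub> a"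
      using that by (simp_all add: us)
    then obtain k where "x \<in> carrier C" "k \<in> core us" "emb H x = a \<otimes>\<^bsub>F H\<^esub> emb H k \<otimes>\<^bsub>F H\<^esub> inv\<^bsub>F H\<^esub> a"
      by blast
    moreover have "core us \<subseteq> carrier C" using core_eq[of us] ss(1) by (auto simp: us reduced_Cons)
    ultimately show ?thesis using a by (auto simp: F.m_assoc intro!: bexI[of _ k])
  qed
  have "c \<in> core ss" using core_eq'[OF ss(1,2)] h c by (auto simp: ss(3))
  \<comment> \<open>A second element is required because \<open>c\<close> itself may be
    trivial.\<close>
  moreover obtain x where x: "x \<in> core ss" "x \<noteq> \<one>\<^bsub>C\<^esub>"
    using Nstar_iff_core[OF ss(1,2)] h(1) one_in_core[OF ss(1)] by (auto simp: ss(3))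
  then have "x \<in> carrier C" by (auto simp: core_eq[OF ss(1)])
  then have "a \<in> Nstar (F H) (im H)"
    unfolding F.Nstar_iff[OF subgroup_im] using commute[OF x(1)] x(2) a
    by (auto intro!: bexI[of _ "emb H x"]) (metis emb_eq_iff C.one_closed emb.hom_one)
  ultimately have "emb H c \<in> Zset (F H) (im H)"
    unfolding F.Zset_iff[OF subgroup_im] using a(2) commute[of c] c by auto
  then show "\<exists>H. emb H c \<in> Zset (F H) (im H)" ..
next
  assume "\<exists>H. emb H c \<in> Zset (F H) (im H)"
  then obtain H a k where a: "a \<in> Nstar (F H) (im H)" "a \<notin> im H" "k \<in> carrier C"
    "emb H c \<otimes>\<^bsub>F H\<^esub> a = a \<otimes>\<^bsub>F H\<^esub> emb H k"
    unfolding F.Zset_iff[OF subgroup_im] by auto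
  obtain x y where x: "x \<in> carrier C" "y \<in> carrier C" "emb H x \<noteq> \<one>\<^bsub>F H\<^esub>"
    "emb H x \<otimes>\<^bsub>F H\<^esub> a = a \<otimes>\<^bsub>F H\<^esub> emb H y" and aF: "a \<in> carrier (F H)"
    using a(1) unfolding F.Nstar_iff[OF subgroup_im] by auto
  have transport: "inc_C u \<otimes>\<^bsub>G\<^esub> inc H a = inc H a \<otimes>\<^bsub>G\<^esub> inc_C v"
    if "u \<in> carrier C" "v \<in> carrier C" "emb H u \<otimes>\<^bsub>F H\<^esub> a = a \<otimes>\<^bsub>F H\<^esub> emb H v" for u v
    using that aF by (metis inc.hom_mult emb.hom_closed inc_emb)
  have "inc H a \<in> Nstar G CG"
    unfolding G.Nstar_iff[OF subgroup_CG] using x aF transport[OF x(1,2,4)]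
    by (auto 0 4 simp: inc_C_eq_one_iff intro: bexI[of _ x])
  moreover have "inc H a \<notin> CG"
    using prod_syllables_in_CG_iff[of "[(H, a)]" "\<one>\<^bsub>C\<^esub>"] a(2) aF by (simp add: reduced_Cons)
  ultimately show "inc_C c \<in> Zset G CG"
    unfolding G.Zset_iff[OF subgroup_CG] using c a(3) transport[OF c a(3,4)] by auto
qed

text \<open>\<open>Zset\<close> lies in C while the other part of the black hole avoids C, so the
  presence of syllables decides which part is relevant.\<close>

lemma black_hole_iff:
  assumes "reduced ss" "d \<in> carrier C"
  shows "prod_syllables ss \<otimes>\<^bsub>G\<^esub> inc_C d \<in> black_hole G CG \<longleftrightarrow>
    (if ss = [] then \<exists>H. emb H d \<in> Zset (F H) (im H) else core ss \<noteq> {\<one>\<^bsub>C\<^esub>})"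
proof (cases "ss = []")
  case True
  then show ?thesis using assms(2) by (simp add: black_hole_def Zset_iff_factors)
next
  case False
  then have "prod_syllables ss \<otimes>\<^bsub>G\<^esub> inc_C d \<notin> CG" using prod_syllables_in_CG_iff[OF assms] by simp
  moreover from this have "prod_syllables ss \<otimes>\<^bsub>G\<^esub> inc_C d \<notin> Zset G CG"
    by (auto simp: G.Zset_iff[OF subgroup_CG])
  ultimately show ?thesis using False Nstar_iff_core[OF assms] by (simp add: black_hole_def)
qed

end

section \<open>The presented amalgamated product\<close>

lemma wmap_append: "wmap f (u @ v) = wmap f u @ wmap f v"
  by (simp add: wmap_def)

lemma wmap_Nil: "wmap f [] = []"
  by (simp add: wmap_def)

lemma wmap_winv: "wmap f (winv w) = winv (wmap f w)"
  by (induction w) (auto simp: wmap_def winv_def)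

lemma words_wmap: "w \<in> words X \<Longrightarrow> f ` X \<subseteq> Y \<Longrightarrow> wmap f w \<in> words Y"
  by (induction w) (auto simp: wmap_def)

lemma eval_word_Nil: "eval_word H zs [] = \<one>\<^bsub>H\<^esub>"
  by (simp add: eval_word_def)

lemma eval_word_Cons:
  "eval_word H zs ((i, b) # w) = (if b then zs ! i else inv\<^bsub>H\<^esub> (zs ! i)) \<otimes>\<^bsub>H\<^esub> eval_word H zs w"
  by (simp add: eval_word_def)

lemma eval_word_append:
  assumes "group H" "set zs \<subseteq> carrier H" "u \<in> words {..<length zs}" "v \<in> words {..<length zs}"
  shows "eval_word H zs (u @ v) = eval_word H zs u \<otimes>\<^bsub>H\<^esub> eval_word H zs v"
  using assms(3)
proof (induction u)
  case Nil
  interpret group H by fact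
  show ?case using eval_word_closed[OF assms(1,2,4)] by (simp add: eval_word_Nil)
next
  case (Cons a u)
  interpret group H by fact
  obtain i b where a: "a = (i, b)" by (cases a)
  then have "zs ! i \<in> carrier H" using Cons.prems assms(2) nth_mem by fastforce
  then show ?case
    using Cons eval_word_closed[OF assms(1,2,4)] eval_word_closed[OF assms(1,2), of u]
    by (simp add: a eval_word_Cons m_assoc)
qed

primrec side :: "factor \<Rightarrow> nat \<Rightarrow> nat + nat" where
  "side FactorA = Inl"
| "side FactorB = Inr"

declare side.simps [simp del]

locale presented_amalgam =
  fixes X :: "factor \<Rightarrow> nat set" and R :: "factor \<Rightarrow> nat gword set"
    and C :: "'c monoid" and zs :: "'c list" and emb :: "factor \<Rightarrow> 'c \<Rightarrow> nat gword set"
    and us :: "factor \<Rightarrow> nat gword list"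
  assumes pres: "finite_presentation (X H) (R H)"
    and C: "group C" and zs: "set zs \<subseteq> carrier C" and gen: "carrier C = generate C (set zs)"
    and mon: "emb H \<in> mon C (pres_group (X H) (R H))"
    and us: "list_all2 (\<lambda>u z. u \<in> words (X H) \<and> cls (X H) (R H) u = emb H z) (us H) zs"
begin

abbreviation F :: "factor \<Rightarrow> nat gword set monoid" where "F H \<equiv> pres_group (X H) (R H)"
abbreviation el :: "factor \<Rightarrow> nat gword \<Rightarrow> nat gword set" where "el H \<equiv> cls (X H) (R H)"
abbreviation GX :: "(nat + nat) set" where "GX \<equiv> amalg_gens (X FactorA) (X FactorB)"
abbreviation GR :: "(nat + nat) gword set" where
  "GR \<equiv> amalg_rels (R FactorA) (R FactorB) (us FactorA) (us FactorB)"
abbreviation G :: "(nat + nat) gword set monoid" where "G \<equiv> pres_group GX GR"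
abbreviation gel :: "(nat + nat) gword \<Rightarrow> (nat + nat) gword set" where "gel \<equiv> cls GX GR"
abbreviation inc :: "factor \<Rightarrow> nat gword set \<Rightarrow> (nat + nat) gword set" where
  "inc H \<equiv> induced_map GX GR (side H)"

lemma R_words: "R H \<subseteq> words (X H)"
  using pres by (simp add: finite_presentation_def)

lemma finite_X: "finite (X H)"
  using pres by (simp add: finite_presentation_def)

sublocale amalgam_data F C emb
  by (rule amalgam_data.intro[OF group_pres_group[OF R_words] C mon])

lemma length_us: "length (us H) = length zs"
  using us by (rule list_all2_lengthD)

lemma us_nth: "i < length zs \<Longrightarrow> us H ! i \<in> words (X H) \<and> el H (us H ! i) = emb H (zs ! i)"
  using us by (simp add: list_all2_conv_all_nth)

lemma words_side: "w \<in> words (X H) \<Longrightarrow> wmap (side H) w \<in> words GX"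
  by (erule words_wmap) (cases H; auto simp: amalg_gens_def side.simps)

lemma GR_words: "GR \<subseteq> words GX"
proof -
  have "u \<in> words (X FactorA)" "v \<in> words (X FactorB)"
    if "(u, v) \<in> set (zip (us FactorA) (us FactorB))" for u v
    using that by (auto simp: set_zip length_us us_nth)
  then show ?thesis
    using R_words[THEN subsetD] words_side[of _ FactorA] words_side[of _ FactorB]
    by (auto simp: amalg_rels_def side.simps)
qed

sublocale G: group G by (rule group_pres_group[OF GR_words])

lemma el_closed [simp]: "w \<in> words (X H) \<Longrightarrow> el H w \<in> carrier (F H)"
  by (simp add: pres_group_carrier)

lemma gel_closed [simp]: "w \<in> words GX \<Longrightarrow> gel w \<in> carrier G"
  by (simp add: pres_group_carrier)

lemma el_append: "u \<in> words (X H) \<Longrightarrow> v \<in> words (X H) \<Longrightarrow> el H (u @ v) = el H u \<otimes>\<^bsub>F H\<^esub> el H v"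
  by (rule pres_group_mult[OF R_words, symmetric])

lemma gel_append: "u \<in> words GX \<Longrightarrow> v \<in> words GX \<Longrightarrow> gel (u @ v) = gel u \<otimes>\<^bsub>G\<^esub> gel v"
  by (rule pres_group_mult[OF GR_words, symmetric])

lemma el_Nil: "el H [] = \<one>\<^bsub>F H\<^esub>"
  by (simp add: pres_group_one)

lemma el_winv: "w \<in> words (X H) \<Longrightarrow> el H (winv w) = inv\<^bsub>F H\<^esub> (el H w)"
  by (rule F.inv_equality[symmetric])
    (simp_all add: el_append[symmetric] el_Nil[symmetric] cls_eq_iff word_eq_winv)

lemma word_eq_side: "word_eq (X H) (R H) u v \<Longrightarrow> word_eq GX GR (wmap (side H) u) (wmap (side H) v)"
proof (induction rule: word_eq.induct)
  case (cancel u v x b)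
  then show ?case
    using word_eq.cancel[OF words_side[OF cancel(1)] words_side[OF cancel(2)], of "side H x" GR b]
    by (cases H) (auto simp: wmap_def amalg_gens_def side.simps)
next
  case (relator u v r)
  then have "wmap (side H) r \<in> GR" by (cases H) (auto simp: amalg_rels_def side.simps)
  with relator show ?case
    using word_eq.relator[OF words_side[OF relator(1)] words_side[OF relator(2)]] by (simp add: wmap_append)
qed (auto intro: word_eq.intros words_side)

lemma inc_el: "w \<in> words (X H) \<Longrightarrow> inc H (el H w) = gel (wmap (side H) w)"
  unfolding induced_map_def cls_def
  by (auto intro: word_eq.trans word_eq_side word_eq.refl)

lemma inc_hom: "inc H \<in> hom (F H) G"
  by (rule homI)
    (auto simp: pres_group_carrier[of "X H"] el_append[symmetric] inc_el words_side gel_append wmap_append)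

text \<open>The relators give the equality on the generating tuple; it extends to products and
  inverses because both sides are homomorphisms.\<close>

lemma inc_emb_eq_AB:
  assumes "c \<in> carrier C"
  shows "inc FactorA (emb FactorA c) = inc FactorB (emb FactorB c)"
proof -
  interpret inc: group_hom "F H" G "inc H" for H
    by unfold_locales (rule inc_hom)
  have zs_C: "z \<in> set zs \<Longrightarrow> z \<in> carrier C" for z using zs by auto
  have gen_C: "generate C (set zs) \<subseteq> carrier C" using gen by simp
  have base: "inc FactorA (emb FactorA z) = inc FactorB (emb FactorB z)" if "z \<in> set zs" for z
  proof -
    obtain i where i: "i < length zs" "z = zs ! i" using \<open>z \<in> set zs\<close> by (auto simp: in_set_conv_nth)
    let ?u = "wmap (side FactorA) (us FactorA ! i)" and ?v = "wmap (side FactorB) (us FactorB ! i)"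
    have w: "?u \<in> words GX" "?v \<in> words GX"
      using us_nth[OF i(1)] words_side by blast+
    have "(us FactorA ! i, us FactorB ! i) \<in> set (zip (us FactorA) (us FactorB))"
      using i(1) by (auto simp: set_zip length_us)
    then have "?u @ winv ?v \<in> GR" by (auto simp: amalg_rels_def side.simps)
    from word_eq.relator[OF _ _ this, of "[]" GX ?v] w
    \<comment> \<open>The word u v^-1 v is reduced in two ways: the relator turns it into v, free
      cancellation into u.\<close>
    have 1: "gel (?u @ winv ?v @ ?v) = gel ?v" by (simp add: cls_eq_iff)
    have "gel (?u @ winv ?v @ ?v) = gel ?u"
      using word_eq_context[OF word_eq_winv[OF w(2)], of ?u "[]"] w by (simp add: cls_eq_iff)
    with 1 have "gel ?u = gel ?v" by simp
    then show ?thesis using us_nth[OF i(1)] i(2) by (metis inc_el)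
  qed
  from assms have "c \<in> generate C (set zs)" by (simp add: gen)
  then show ?thesis
  proof induction
    case (inv h)
    then show ?case using base[OF inv] zs_C by simp
  next
    case (eng h1 h2)
    then have "h1 \<in> carrier C" "h2 \<in> carrier C" using gen_C by auto
    with eng.IH show ?case by simp
  qed (auto simp: base)
qed

sublocale amalgam_cone F C emb G inc
proof
  show "inc H \<in> hom (F H) G" for H by (rule inc_hom)
  show "inc H (emb H c) = inc K (emb K c)" if "c \<in> carrier C" for c H K
    using inc_emb_eq_AB[OF that] by (cases H; cases K) auto
qed

section \<open>The action of words of G on normal forms\<close>

fun syllable :: "(nat + nat) \<times> bool \<Rightarrow> factor \<times> nat gword" where
  "syllable (Inl x, b) = (FactorA, [(x, b)])"
| "syllable (Inr x, b) = (FactorB, [(x, b)])"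

lemma syllable_side: "syllable (side H x, b) = (H, [(x, b)])"
  by (cases H) (auto simp: side.simps)

lemma letter_cases:
  assumes "fst l \<in> GX"
  obtains H x b where "l = (side H x, b)" "x \<in> X H"
  using assms that[of FactorA] that[of FactorB] by (cases l) (auto simp: amalg_gens_def side.simps)

definition word_act :: "(nat + nat) gword \<Rightarrow> 'c \<times> (factor \<times> nat gword set) list \<Rightarrow>
    'c \<times> (factor \<times> nat gword set) list" where
  "word_act w p = foldr (\<lambda>l. case syllable l of (H, v) \<Rightarrow> act H (el H v)) w p"

lemma word_act_append: "word_act (u @ v) p = word_act u (word_act v p)"
  by (simp add: word_act_def)

lemma word_act_Nil [simp]: "word_act [] p = p"
  by (simp add: word_act_def)

lemma word_act_side:
  "w \<in> words (X H) \<Longrightarrow> p \<in> Omega \<Longrightarrow> word_act (wmap (side H) w) p = act H (el H w) p"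
proof (induction w)
  case Nil then show ?case by (simp add: wmap_Nil el_Nil act_one)
next
  case (Cons a w)
  obtain x b where a: "a = (x, b)" by (cases a)
  have "word_act (wmap (side H) (a # w)) p = act H (el H [(x, b)]) (act H (el H w) p)"
    using Cons by (simp add: a word_act_def wmap_def syllable_side)
  also have "\<dots> = act H (el H ([(x, b)] @ w)) p"
    using Cons.prems by (simp add: a act_mult el_append del: append_Cons)
  finally show ?case by (simp add: a)
qed

lemma word_act_closed: "w \<in> words GX \<Longrightarrow> p \<in> Omega \<Longrightarrow> word_act w p \<in> Omega"
proof (induction w)
  case (Cons l w)
  then obtain H x b where "l = (side H x, b)" "x \<in> X H" using letter_cases[of l] by auto
  then show ?case using Cons by (simp add: word_act_def syllable_side act_closed)
qed simp

text \<open>A relator of a factor represents 1 there. A relator identifying the two copies of a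
  generator z of C acts by z^-1 through B and then by z through A; by \<open>act_emb\<close> both
  only change the C-part, where they cancel.\<close>

lemma word_act_relator:
  assumes "r \<in> GR" "p \<in> Omega"
  shows "word_act r p = p"
proof -
  have *: "word_act (wmap (side H) r) p = p" if "r \<in> R H" for H r
  proof -
    have r: "r \<in> words (X H)" using that R_words by auto
    have "el H r = \<one>\<^bsub>F H\<^esub>"
      using word_eq.relator[of "[]" "X H" "[]", OF _ _ that] by (simp add: el_Nil[symmetric] cls_eq_iff)
    then show ?thesis using word_act_side[OF r assms(2)] assms(2) by (simp add: act_one)
  qed
  consider H s where "s \<in> R H" "r = wmap (side H) s"
    | i where "i < length zs" "r = wmap (side FactorA) (us FactorA ! i) @ winv (wmap (side FactorB) (us FactorB ! i))"
    using assms(1) unfolding amalg_rels_def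
    by (auto simp: set_zip length_us) (metis side.simps)+
  then show ?thesis
  proof cases
    case (2 i)
    obtain c ts where p: "p = (c, ts)" by (cases p)
    have z: "zs ! i \<in> carrier C" using zs 2(1) by auto
    have "word_act r p = act FactorA (emb FactorA (zs ! i)) (act FactorB (emb FactorB (inv\<^bsub>C\<^esub> (zs ! i))) p)"
      using us_nth[OF 2(1)] assms(2) z
      by (simp add: 2(2) word_act_append wmap_winv[symmetric] word_act_side el_winv act_closed)
    also have "\<dots> = p"
    proof -
      have c: "c \<in> carrier C" "(inv\<^bsub>C\<^esub> (zs ! i) \<otimes>\<^bsub>C\<^esub> c, ts) \<in> Omega"
        using assms(2) z by (auto simp: p Omega_def)
      then show ?thesis using assms(2) z
        by (simp add: p act_emb C.m_assoc[symmetric] del: emb.hom_inv)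
    qed
    finally show ?thesis .
  qed (use * in auto)
qed

text \<open>Cancelling pairs and relators fix every point of \<open>Omega\<close>, wherever they are
  inserted, so the action of words descends to G.\<close>

lemma word_act_cong: "word_eq GX GR u v \<Longrightarrow> p \<in> Omega \<Longrightarrow> word_act u p = word_act v p"
proof (induction arbitrary: p rule: word_eq.induct)
  case (cancel u v x b)
  obtain H y where x: "x = side H y" "y \<in> X H"
    using letter_cases[of "(x, b)"] cancel by auto
  have "word_act [(x, b), (x, \<not> b)] q = q" if "q \<in> Omega" for q
  proof -
    have "el H [(y, b), (y, \<not> b)] = el H []"
      using word_eq.cancel[of "[]" "X H" "[]" y "R H" b] x by (simp add: cls_eq_iff)
    then have "word_act (wmap (side H) [(y, b), (y, \<not> b)]) q = q"
      using x that by (subst word_act_side) (simp_all add: act_one el_Nil)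
    then show ?thesis by (simp add: wmap_def x)
  qed
  then show ?case using cancel word_act_closed[of v p] by (simp only: word_act_append)
next
  case (relator u v r)
  then show ?case using word_act_closed[of v p] by (simp only: word_act_append word_act_relator)
qed auto

lemma gel_eq_word_act: "gel u = gel v \<Longrightarrow> v \<in> words GX \<Longrightarrow> p \<in> Omega \<Longrightarrow> word_act u p = word_act v p"
  by (simp add: cls_eq_iff word_act_cong)

text \<open>Links products in G with the action: one word represents the product and acts as the
  composite of its syllables.\<close>

lemma syllables_word:
  assumes "reduced ss" "c \<in> carrier C"
  obtains w where "w \<in> words GX" "gel w = prod_syllables ss \<otimes>\<^bsub>G\<^esub> inc_C c"
    "\<And>d ts. (d, ts) \<in> Omega \<Longrightarrow> word_act w (d, ts) = foldr (\<lambda>(H, a). act H a) ss (c \<otimes>\<^bsub>C\<^esub> d, ts)"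
proof -
  have word: "\<exists>v \<in> words (X H). a = el H v" if "a \<in> carrier (F H)" for a H
    using that by (auto simp: pres_group_carrier)
  have "\<exists>w \<in> words GX. gel w = prod_syllables ss \<otimes>\<^bsub>G\<^esub> inc_C c \<and> (\<forall>d ts. (d, ts) \<in> Omega \<longrightarrow>
      word_act w (d, ts) = foldr (\<lambda>(H, a). act H a) ss (c \<otimes>\<^bsub>C\<^esub> d, ts))"
    using assms(1)
  proof (induction ss)
    case Nil
    obtain v where v: "v \<in> words (X FactorA)" "emb FactorA c = el FactorA v"
      using word assms(2) by (metis emb.hom_closed)
    then have "inc_C c = gel (wmap (side FactorA) v)" using inc_el by (metis inc_C_def)
    moreover have "act FactorA (el FactorA v) (d, ts) = (c \<otimes>\<^bsub>C\<^esub> d, ts)" if "(d, ts) \<in> Omega" for d ts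
      using act_emb[OF assms(2) that, of FactorA] v(2) by simp
    ultimately show ?case using v words_side[OF v(1)]
      by (intro bexI[of _ "wmap (side FactorA) v"]) (auto simp: word_act_side)
  next
    case (Cons s ss)
    obtain H a where s: "s = (H, a)" by (cases s)
    obtain w where w: "w \<in> words GX" "gel w = prod_syllables ss \<otimes>\<^bsub>G\<^esub> inc_C c"
      "\<forall>d ts. (d, ts) \<in> Omega \<longrightarrow>
         word_act w (d, ts) = foldr (\<lambda>(H, a). act H a) ss (c \<otimes>\<^bsub>C\<^esub> d, ts)"
      using Cons by (auto simp: s reduced_Cons)
    have a: "a \<in> carrier (F H)" "reduced ss" using Cons.prems by (auto simp: s reduced_Cons)
    then obtain v where v: "v \<in> words (X H)" "a = el H v" using word by blast
    have "gel (wmap (side H) v @ w) = prod_syllables (s # ss) \<otimes>\<^bsub>G\<^esub> inc_C c"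
      using v w words_side[OF v(1)] a prod_syllables_closed assms(2)
      by (simp add: s gel_append inc_el[symmetric] G.m_assoc)
    then show ?case using v w words_side[OF v(1)] word_act_closed[OF w(1)]
      by (intro bexI[of _ "wmap (side H) v @ w"]) (auto simp: s word_act_append word_act_side)
  qed
  then show thesis using that by blast
qed

text \<open>Equal elements of G move the base point \<open>(1, [])\<close> to the same normal
  form.\<close>

lemma syllables_act:
  assumes "reduced ss" "reduced ts" "c \<in> carrier C" "d \<in> carrier C"
    and "prod_syllables ss \<otimes>\<^bsub>G\<^esub> inc_C c = prod_syllables ts \<otimes>\<^bsub>G\<^esub> inc_C d"
  shows "foldr (\<lambda>(H, a). act H a) ss (c, []) = foldr (\<lambda>(H, a). act H a) ts (d, [])"
proof -
  have start: "(\<one>\<^bsub>C\<^esub>, []) \<in> Omega" by (simp add: Omega_def)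
  have eval: "\<exists>w \<in> words GX. gel w = prod_syllables rs \<otimes>\<^bsub>G\<^esub> inc_C b \<and>
      word_act w (\<one>\<^bsub>C\<^esub>, []) = foldr (\<lambda>(H, a). act H a) rs (b, [])"
    if rs: "reduced rs" "b \<in> carrier C" for rs b
  proof -
    obtain w where w: "w \<in> words GX" "gel w = prod_syllables rs \<otimes>\<^bsub>G\<^esub> inc_C b"
      "\<And>d ts. (d, ts) \<in> Omega \<Longrightarrow> word_act w (d, ts) = foldr (\<lambda>(H, a). act H a) rs (b \<otimes>\<^bsub>C\<^esub> d, ts)"
      by (rule syllables_word[OF rs]) blast
    show ?thesis using w(1,2) w(3)[OF start] C.r_one[OF rs(2)] by (intro bexI[of _ w]) simp_all
  qed
  obtain u v where uv: "u \<in> words GX" "v \<in> words GX" "gel u = gel v"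
    "word_act u (\<one>\<^bsub>C\<^esub>, []) = foldr (\<lambda>(H, a). act H a) ss (c, [])"
    "word_act v (\<one>\<^bsub>C\<^esub>, []) = foldr (\<lambda>(H, a). act H a) ts (d, [])"
    using eval[OF assms(1,3)] eval[OF assms(2,4)] unfolding assms(5) by blast
  show ?thesis using gel_eq_word_act[OF uv(3,2) start] unfolding uv(4,5) .
qed

lemma syllables_length:
  assumes "reduced ss" "reduced ts" "c \<in> carrier C" "d \<in> carrier C"
    and "prod_syllables ss \<otimes>\<^bsub>G\<^esub> inc_C c = prod_syllables ts \<otimes>\<^bsub>G\<^esub> inc_C d"
  shows "length ss = length ts"
proof -
  obtain c' ss' where 1: "foldr (\<lambda>(H, a). act H a) ss (c, []) = (c', ss')" "map fst ss' = map fst ss"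
    by (rule act_reduced[OF assms(1,3)]) blast
  obtain d' ts' where 2: "foldr (\<lambda>(H, a). act H a) ts (d, []) = (d', ts')" "map fst ts' = map fst ts"
    by (rule act_reduced[OF assms(2,4)]) blast
  have "ss' = ts'" using syllables_act[OF assms] unfolding 1(1) 2(1) by simp
  then show ?thesis using 1(2) 2(2) by (metis length_map)
qed

text \<open>C moves the base point to \<open>(c, [])\<close>, from which c is recovered.\<close>

lemma inc_C_inj_aux:
  assumes "c \<in> carrier C" "inc_C c = \<one>\<^bsub>G\<^esub>"
  shows "c = \<one>\<^bsub>C\<^esub>"
  using syllables_act[OF reduced_Nil reduced_Nil assms(1) C.one_closed] assms(2) by simp

text \<open>A word in the generators of C names the same element of C in both factors. This is how
  an element found to lie in C is rewritten in the other factor.\<close>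

lemma subst_word:
  "v \<in> words {..<length zs} \<Longrightarrow> subst_word (us H) v \<in> words (X H) \<and>
     el H (subst_word (us H) v) = emb H (eval_word C zs v)"
proof (induction v)
  case Nil show ?case by (simp add: subst_word_def el_Nil eval_word_Nil)
next
  case (Cons a v)
  obtain i b where a: "a = (i, b)" by (cases a)
  have i: "i < length zs" using Cons.prems by (simp add: a)
  have v: "eval_word C zs v \<in> carrier C" "zs ! i \<in> carrier C"
    using eval_word_closed[OF C zs, of v] Cons.prems zs i by auto
  have "subst_word (us H) (a # v) = (if b then us H ! i else winv (us H ! i)) @ subst_word (us H) v"
    by (simp add: subst_word_def a)
  then show ?case using Cons us_nth[OF i] v by (auto simp: a eval_word_Cons el_append el_winv)
qed

end

section \<open>The decision procedure\<close>

text \<open>The first component is a word in the generators of C and stands for the C-part, placed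
  to the right of all syllables. Multiplication on the left then works at the front of the list and
  reaches the C-part only when no syllable is left.\<close>

type_synonym nform = "nat gword \<times> (factor \<times> nat gword) list"

definition glue :: "factor \<times> nat gword \<Rightarrow> (factor \<times> nat gword) list \<Rightarrow> nform" where
  "glue s ss = (if ss = [] then (snd s, ss)
     else if fst (hd ss) = fst s then (snd s @ snd (hd ss), tl ss) else (snd s, ss))"

locale amalgam_membership = presented_amalgam X R C zs emb us
  for X R and C :: "'c monoid" and zs emb us +
  fixes mem :: "factor \<Rightarrow> nat gword \<Rightarrow> nat gword option"
  assumes mem: "w \<in> words (X H) \<Longrightarrow> (case mem H w of None \<Rightarrow> el H w \<notin> im H
     | Some v \<Rightarrow> el H w \<in> im H \<and> v \<in> words {..<length zs} \<and> el H (subst_word (us H) v) = el H w)"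
begin

abbreviation ev :: "nat gword \<Rightarrow> 'c" where "ev \<equiv> eval_word C zs"

lemma mem_None: "w \<in> words (X H) \<Longrightarrow> mem H w = None \<Longrightarrow> el H w \<notin> im H"
  using mem[of w H] by simp

lemma mem_Some:
  assumes "w \<in> words (X H)" "mem H w = Some v"
  shows "v \<in> words {..<length zs}" "emb H (ev v) = el H w"
  using mem[OF assms(1)] assms(2) subst_word[of v H] by auto

lemma ev_closed [simp]: "v \<in> words {..<length zs} \<Longrightarrow> ev v \<in> carrier C"
  by (rule eval_word_closed[OF C zs])

lemma ev_append: "u \<in> words {..<length zs} \<Longrightarrow> v \<in> words {..<length zs} \<Longrightarrow> ev (u @ v) = ev u \<otimes>\<^bsub>C\<^esub> ev v"
  by (rule eval_word_append[OF C zs])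

definition syl_words :: "(factor \<times> nat gword) set" where
  "syl_words = (SIGMA H:UNIV. words (X H))"

definition els :: "(factor \<times> nat gword) list \<Rightarrow> (factor \<times> nat gword set) list" where
  "els = map (\<lambda>(H, w). (H, el H w))"

lemma els_simps [simp]: "els [] = []" "els ((H, w) # ss) = (H, el H w) # els ss"
  by (simp_all add: els_def)

definition good :: "nform set" where
  "good = {(v, ss). v \<in> words {..<length zs} \<and> ss \<in> lists syl_words \<and> reduced (els ss)}"

definition val :: "nform \<Rightarrow> (nat + nat) gword set" where
  "val st = prod_syllables (els (snd st)) \<otimes>\<^bsub>G\<^esub> inc_C (ev (fst st))"

text \<open>Left multiplication by an element of a factor. The element first swallows a leading
  syllable of its own factor. If the result is outside C, it becomes the new first syllable. If it
  is in C, it is rewritten in the generators of C and absorbed by the next syllable, or by the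
  C-part if there is none.\<close>

definition push :: "factor \<times> nat gword \<Rightarrow> nform \<Rightarrow> nform" where
  "push s st = (if mem (fst s) (fst (glue s (snd st))) = None
     then (fst st, (fst s, fst (glue s (snd st))) # snd (glue s (snd st)))
     else if snd (glue s (snd st)) = []
     then (the (mem (fst s) (fst (glue s (snd st)))) @ fst st, [])
     else (fst st, (fst (hd (snd (glue s (snd st)))),
       subst_word (us (fst (hd (snd (glue s (snd st)))))) (the (mem (fst s) (fst (glue s (snd st)))))
         @ snd (hd (snd (glue s (snd st))))) # tl (snd (glue s (snd st)))))"

lemma glue:
  assumes "(v, ss) \<in> good" "w \<in> words (X H)" and g: "glue (H, w) ss = (w', ss')"
  shows "w' \<in> words (X H)" "(v, ss') \<in> good" "\<not> starts H (els ss')"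
    "inc H (el H w') \<otimes>\<^bsub>G\<^esub> prod_syllables (els ss') = inc H (el H w) \<otimes>\<^bsub>G\<^esub> prod_syllables (els ss)"
proof -
  have "w' \<in> words (X H) \<and> (v, ss') \<in> good \<and> \<not> starts H (els ss') \<and>
    inc H (el H w') \<otimes>\<^bsub>G\<^esub> prod_syllables (els ss') = inc H (el H w) \<otimes>\<^bsub>G\<^esub> prod_syllables (els ss)"
  proof (cases ss)
    case Nil
    then show ?thesis using assms by (auto simp: glue_def)
  next
    case (Cons s rest)
    obtain K y where s: "s = (K, y)" by (cases s)
    have y: "y \<in> words (X K)" "reduced (els rest)" "\<not> starts K (els rest)" "el K y \<in> carrier (F K) - im K"
      "v \<in> words {..<length zs}" "rest \<in> lists syl_words"
      using assms(1) by (auto simp: Cons s good_def syl_words_def reduced_Cons)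
    note cl = prod_syllables_closed[OF y(2)]
    show ?thesis
    proof (cases "K = H")
      case True
      then have "w' = w @ y" "ss' = rest" using g by (auto simp: glue_def Cons s)
      then show ?thesis using y cl assms(2) True
        by (simp add: Cons s good_def el_append G.m_assoc)
    next
      case False
      then have "w' = w" "ss' = ss" using g by (auto simp: glue_def Cons s)
      then show ?thesis using assms False by (simp add: Cons s)
    qed
  qed
  then show "w' \<in> words (X H)" "(v, ss') \<in> good" "\<not> starts H (els ss')"
    "inc H (el H w') \<otimes>\<^bsub>G\<^esub> prod_syllables (els ss') = inc H (el H w) \<otimes>\<^bsub>G\<^esub> prod_syllables (els ss)"
    by blast+
qed

lemma push:
  assumes "st \<in> good" "w \<in> words (X H)"
  shows "push (H, w) st \<in> good" "val (push (H, w) st) = inc H (el H w) \<otimes>\<^bsub>G\<^esub> val st"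
proof -
  obtain v ss where st: "st = (v, ss)" by (cases st)
  obtain w' ss' where g: "glue (H, w) ss = (w', ss')" by (cases "glue (H, w) ss")
  note gl = glue[OF assms(1)[unfolded st] assms(2) g]
  have v: "v \<in> words {..<length zs}" and red: "reduced (els ss)" "reduced (els ss')"
    "ss' \<in> lists syl_words"
    using assms(1) gl(2) by (auto simp: st good_def)
  note cl = prod_syllables_closed[OF red(1)] prod_syllables_closed[OF red(2)]
  have goal: "inc H (el H w) \<otimes>\<^bsub>G\<^esub> val st
      = inc H (el H w') \<otimes>\<^bsub>G\<^esub> prod_syllables (els ss') \<otimes>\<^bsub>G\<^esub> inc_C (ev v)"
    using cl v assms(2) by (simp add: gl(4) val_def st G.m_assoc)
  have "push (H, w) st \<in> good \<and> val (push (H, w) st)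
      = inc H (el H w') \<otimes>\<^bsub>G\<^esub> prod_syllables (els ss') \<otimes>\<^bsub>G\<^esub> inc_C (ev v)"
  proof (cases "mem H w'")
    case None
    then have p: "push (H, w) st = (v, (H, w') # ss')" by (simp add: push_def st g)
    show ?thesis using mem_None[OF gl(1) None] gl(1,3) red v
      by (simp add: p good_def val_def reduced_Cons syl_words_def)
  next
    case (Some u)
    note u = mem_Some[OF gl(1) Some]
    have inc_w': "inc H (el H w') = inc_C (ev u)" using u inc_emb[of "ev u" H] by simp
    show ?thesis
    proof (cases ss')
      case Nil
      then have p: "push (H, w) st = (u @ v, [])" using Some by (simp add: push_def st g)
      show ?thesis using u(1) v by (simp add: p good_def val_def Nil inc_w' ev_append)
    next
      case (Cons s rest)
      obtain K y where s: "s = (K, y)" by (cases s)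
      have p: "push (H, w) st = (v, (K, subst_word (us K) u @ y) # rest)"
        using Some by (simp add: push_def st g Cons s)
      have y: "y \<in> words (X K)" "reduced (els rest)" "\<not> starts K (els rest)"
          "el K y \<in> carrier (F K)" "el K y \<notin> im K" "rest \<in> lists syl_words"
        using red by (auto simp: Cons s syl_words_def reduced_Cons)
      have e: "el K (subst_word (us K) u @ y) = emb K (ev u) \<otimes>\<^bsub>F K\<^esub> el K y"
        using subst_word[OF u(1), of K] y by (simp add: el_append)
      \<comment> \<open>Multiplying a syllable by an element of C keeps it outside C, so absorption
        never cascades further.\<close>
      have "push (H, w) st \<in> good"
        using subst_word[OF u(1), of K] y v mult_im_left[of "ev u" "el K y" K] u(1)
        by (simp add: p good_def reduced_Cons syl_words_def e)
      moreover have "val (push (H, w) st) = inc_C (ev u) \<otimes>\<^bsub>G\<^esub> (inc K (el K y) \<otimes>\<^bsub>G\<^esub> prod_syllables (els rest)) \<otimes>\<^bsub>G\<^esub> inc_C (ev v)"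
        using u(1) y v prod_syllables_closed[OF y(2)] by (simp add: p val_def e inc_emb G.m_assoc)
      ultimately show ?thesis by (simp add: inc_w' Cons s)
    qed
  qed
  with goal show "push (H, w) st \<in> good" "val (push (H, w) st) = inc H (el H w) \<otimes>\<^bsub>G\<^esub> val st"
    by simp_all
qed

definition normalize :: "(nat + nat) gword \<Rightarrow> nform" where
  "normalize w = foldr (\<lambda>l. push (syllable l)) w ([], [])"

lemma normalize: "w \<in> words GX \<Longrightarrow> normalize w \<in> good \<and> val (normalize w) = gel w"
proof (induction w)
  case Nil
  show ?case by (simp add: normalize_def good_def val_def eval_word_Nil pres_group_one)
next
  case (Cons l w)
  obtain H x b where l: "l = (side H x, b)" "x \<in> X H" using letter_cases[of l] Cons.prems by auto
  have x: "[(x, b)] \<in> words (X H)" using l by simp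
  have IH: "normalize w \<in> good" "val (normalize w) = gel w" using Cons by simp_all
  have "gel (l # w) = gel (wmap (side H) [(x, b)]) \<otimes>\<^bsub>G\<^esub> gel w"
  proof -
    have "l # w = wmap (side H) [(x, b)] @ w" by (simp add: l(1) wmap_def)
    then show ?thesis using gel_append[OF words_side[OF x], of w] Cons.prems by (simp only: words_simps)
  qed
  also have "\<dots> = inc H (el H [(x, b)]) \<otimes>\<^bsub>G\<^esub> val (normalize w)"
    using IH(2) inc_el[OF x] by simp
  finally have "gel (l # w) = inc H (el H [(x, b)]) \<otimes>\<^bsub>G\<^esub> val (normalize w)" .
  moreover have "normalize (l # w) = push (H, [(x, b)]) (normalize w)"
    by (simp add: normalize_def l(1) syllable_side)
  ultimately show ?case using push[OF IH(1) x] by simp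
qed

text \<open>Existence of reduced products comes from running the normalization, invariance of the
  syllable count and injectivity on C from the action on \<open>Omega\<close>.\<close>

sublocale amalgam F C emb G inc
proof
  fix g assume "g \<in> carrier G"
  then obtain w where "w \<in> words GX" "g = gel w" by (auto simp: pres_group_carrier)
  then show "\<exists>ss c. reduced ss \<and> c \<in> carrier C \<and> g = prod_syllables ss \<otimes>\<^bsub>G\<^esub> inc_C c"
    using normalize[of w]
    by (intro exI[of _ "els (snd (normalize w))"] exI[of _ "ev (fst (normalize w))"])
      (auto simp: good_def val_def)
qed (use syllables_length inc_C_inj_aux in blast)+

section \<open>Effective descriptions of cores and of trivial words\<close>

abbreviation set_val :: "set_expr \<Rightarrow> factor \<Rightarrow> nat gword set set" where
  "set_val \<equiv> set_of_expr X R C zs emb"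
abbreviation sub_val :: "sub_expr \<Rightarrow> 'c set" where
  "sub_val \<equiv> sub_of_expr X R C zs emb"
abbreviation set_ok :: "set_expr \<Rightarrow> factor \<Rightarrow> bool" where
  "set_ok \<equiv> valid_set_expr X R C zs emb"
abbreviation sub_ok :: "sub_expr \<Rightarrow> bool" where
  "sub_ok \<equiv> valid_sub_expr X R C zs emb"

lemma valid_in_Phi: "set_ok D H \<Longrightarrow> set_val D H \<in> Phi (Sub (F H) (im H)) (F H)"
  by (rule valid_expr(1)[where X=X and R=R and emb=emb, OF C zs R_words emb.homh])

lemma subgroup_sub_val: "sub_ok K \<Longrightarrow> subgroup (sub_val K) C"
  by (rule valid_expr(2)[where X=X and R=R and emb=emb, OF C zs R_words emb.homh])

definition top_expr :: sub_expr where
  "top_expr = Generated (map (\<lambda>i. [(i, True)]) [0..<length zs])"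

lemma top_expr: "sub_ok top_expr" "sub_val top_expr = carrier C"
proof -
  show "sub_ok top_expr" by (auto simp: top_expr_def)
  have "ev [(i, True)] = zs ! i" if "i < length zs" for i
    using subsetD[OF zs nth_mem[OF that]] by (simp add: eval_word_Cons eval_word_Nil)
  then have "ev ` set (map (\<lambda>i. [(i, True)]) [0..<length zs]) = (\<lambda>i. zs ! i) ` {..<length zs}"
    by (auto simp: image_image atLeast0LessThan intro!: image_cong)
  also have "\<dots> = set zs" by (auto simp: set_conv_nth)
  finally show "sub_val top_expr = carrier C" by (simp add: top_expr_def gen)
qed

text \<open>The inner expression describes the intersection of w K w^-1 with C as a subset of one
  factor. Translating by the empty word leaves the set as it is, but makes it a description of a
  subgroup of C, which either factor can use next.\<close>

definition core_step :: "factor \<times> nat gword \<Rightarrow> sub_expr \<Rightarrow> sub_expr" where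
  "core_step s K = Translate (fst s)
     (Inter (Shift (snd s) (Base K) (winv (snd s))) (Base top_expr)) []"

lemma core_step:
  assumes "sub_ok K" "w \<in> words (X H)"
  shows "sub_val (core_step (H, w) K) =
      {c \<in> carrier C. \<exists>k \<in> sub_val K. emb H c = el H w \<otimes>\<^bsub>F H\<^esub> emb H k \<otimes>\<^bsub>F H\<^esub> inv\<^bsub>F H\<^esub> (el H w)}"
    and "sub_ok (core_step (H, w) K)"
proof -
  have "subgroup (sub_val K) C"
    by (rule subgroup_sub_val[OF assms(1)])
  then interpret K: subgroup "sub_val K" C .
  let ?D = "set_val (Inter (Shift w (Base K) (winv w)) (Base top_expr)) H"
  have D: "?D = {emb H c | c. c \<in> carrier C \<and>
       (\<exists>k \<in> sub_val K. emb H c = el H w \<otimes>\<^bsub>F H\<^esub> emb H k \<otimes>\<^bsub>F H\<^esub> inv\<^bsub>F H\<^esub> (el H w))}"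
    using assms(2) by (auto simp: top_expr(2) el_winv l_coset_def r_coset_def)
  \<comment> \<open>\<open>Translate\<close> is valid only if its element lies in the set; here this
    element is 1.\<close>
  have one: "\<one>\<^bsub>F H\<^esub> \<in> ?D"
    unfolding D using assms(2) by (auto intro!: exI[of _ "\<one>\<^bsub>C\<^esub>"] bexI[of _ "\<one>\<^bsub>C\<^esub>"])
  have "?D #>\<^bsub>F H\<^esub> inv\<^bsub>F H\<^esub> (el H []) = ?D"
  proof -
    have "?D \<subseteq> carrier (F H)" unfolding D by auto
    then show ?thesis by (simp add: el_Nil F.coset_mult_one del: set_of_expr.simps)
  qed
  then show "sub_val (core_step (H, w) K) =
      {c \<in> carrier C. \<exists>k \<in> sub_val K. emb H c = el H w \<otimes>\<^bsub>F H\<^esub> emb H k \<otimes>\<^bsub>F H\<^esub> inv\<^bsub>F H\<^esub> (el H w)}"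
    unfolding core_step_def fst_conv snd_conv sub_of_expr.simps(2) D by auto
  show "sub_ok (core_step (H, w) K)"
    unfolding core_step_def fst_conv snd_conv valid_sub_expr.simps
    using assms top_expr(1) one unfolding D by (auto simp: el_Nil)
qed

definition core_expr :: "(factor \<times> nat gword) list \<Rightarrow> sub_expr" where
  "core_expr ss = foldr core_step ss top_expr"

lemma core_expr:
  "ss \<in> lists syl_words \<Longrightarrow> sub_ok (core_expr ss) \<and> sub_val (core_expr ss) = core (els ss)"
proof (induction ss)
  case Nil show ?case by (simp add: core_expr_def top_expr)
next
  case (Cons s ss)
  obtain H w where s: "s = (H, w)" by (cases s)
  have w: "w \<in> words (X H)" and "ss \<in> lists syl_words" using Cons.prems by (auto simp: s syl_words_def)
  then have "sub_ok (core_expr ss)" "sub_val (core_expr ss) = core (els ss)" using Cons.IH by auto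
  with core_step[OF this(1) w] show ?case by (simp add: core_expr_def s)
qed

text \<open>The empty tuple generates the trivial subgroup, so this is the intersection of {w} and
  {1}: a question about triviality of w becomes one about emptiness.\<close>

definition word_expr :: "nat gword \<Rightarrow> set_expr" where
  "word_expr w = Inter (Shift w (Base (Generated [])) []) (Base (Generated []))"

lemma word_expr:
  assumes "w \<in> words (X H)"
  shows "set_ok (word_expr w) H" "set_val (word_expr w) H = {} \<longleftrightarrow> el H w \<noteq> \<one>\<^bsub>F H\<^esub>"
proof -
  show "set_ok (word_expr w) H" using assms by (simp add: word_expr_def)
  have "set_val (word_expr w) H = {el H w} \<inter> {\<one>\<^bsub>F H\<^esub>}"
    using assms by (simp add: word_expr_def C.generate_empty l_coset_def r_coset_def el_Nil)
  then show "set_val (word_expr w) H = {} \<longleftrightarrow> el H w \<noteq> \<one>\<^bsub>F H\<^esub>" by auto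
qed

end

section \<open>Deciding triviality of a described subgroup\<close>

locale amalgam_oracles = amalgam_membership X R C zs emb us mem
  for X R and C :: "'c monoid" and zs emb us mem +
  fixes card_of :: "set_expr \<Rightarrow> card_answer" and in_Z :: "factor \<Rightarrow> nat gword \<Rightarrow> bool"
  assumes card_of: "set_ok D FactorA \<Longrightarrow>
      correct_card_answer (X FactorA) (R FactorA) (set_val D FactorA) (card_of D)"
    and in_Z: "w \<in> words (X H) \<Longrightarrow> in_Z H w \<longleftrightarrow> el H w \<in> Zset (F H) (im H)"
begin

text \<open>The default \<open>[]\<close> is harmless: a subgroup is never reported empty, and the
  infinite answer is intercepted before the list is read.\<close>

fun listing :: "card_answer \<Rightarrow> nat gword list" where
  "listing (Is_finite ws) = ws"
| "listing _ = []"

definition nontrivial_word :: "nat gword \<Rightarrow> bool" where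
  "nontrivial_word w \<longleftrightarrow> card_of (word_expr w) = Is_empty"

text \<open>The embedding is injective, so triviality is tested on the image in A. A finite answer
  may repeat elements under different words; its length proves nothing, and its entries have to be
  tested.\<close>

definition nontrivial_sub :: "sub_expr \<Rightarrow> bool" where
  "nontrivial_sub K \<longleftrightarrow> (if card_of (Base K) = Is_infinite then True
     else foldr (\<lambda>w b. nontrivial_word w \<or> b) (listing (card_of (Base K))) False)"

definition singular :: "nform \<Rightarrow> bool" where
  "singular st \<longleftrightarrow> (if snd st = []
     then in_Z FactorA (subst_word (us FactorA) (fst st)) \<or> in_Z FactorB (subst_word (us FactorB) (fst st))
     else nontrivial_sub (core_expr (snd st)))"

lemma nontrivial_word:
  assumes "w \<in> words (X FactorA)"
  shows "nontrivial_word w \<longleftrightarrow> el FactorA w \<noteq> \<one>\<^bsub>F FactorA\<^esub>"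
  using card_of[OF word_expr(1)[OF assms]] word_expr(2)[OF assms]
  by (auto simp: nontrivial_word_def correct_card_answer_def split: card_answer.splits)

text \<open>A subgroup contains 1, which rules out the answer \<open>Is_empty\<close>.\<close>

lemma card_of_sub:
  assumes "sub_ok K"
  shows "card_of (Base K) = Is_infinite \<or> (\<exists>ws. card_of (Base K) = Is_finite ws \<and>
     set ws \<subseteq> words (X FactorA) \<and> el FactorA ` set ws = emb FactorA ` sub_val K)"
    and "card_of (Base K) = Is_infinite \<Longrightarrow> infinite (sub_val K)"
proof -
  have "subgroup (sub_val K) C"
    by (rule subgroup_sub_val[OF assms])
  then have "sub_val K \<noteq> {}" by (auto dest: subgroup.one_closed)
  moreover have "correct_card_answer (X FactorA) (R FactorA) (emb FactorA ` sub_val K) (card_of (Base K))"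
    using card_of[of "Base K"] assms by simp
  ultimately show "card_of (Base K) = Is_infinite \<or> (\<exists>ws. card_of (Base K) = Is_finite ws \<and>
     set ws \<subseteq> words (X FactorA) \<and> el FactorA ` set ws = emb FactorA ` sub_val K)"
    and "card_of (Base K) = Is_infinite \<Longrightarrow> infinite (sub_val K)"
    by (auto simp: correct_card_answer_def split: card_answer.splits)
qed

lemma nontrivial_sub:
  assumes "sub_ok K"
  shows "nontrivial_sub K \<longleftrightarrow> sub_val K \<noteq> {\<one>\<^bsub>C\<^esub>}"
proof -
  have sub: "subgroup (sub_val K) C"
    by (rule subgroup_sub_val[OF assms])
  show ?thesis
  proof (cases "card_of (Base K) = Is_infinite")
    case True
    then show ?thesis using card_of_sub(2)[OF assms] by (auto simp: nontrivial_sub_def)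
  next
    case False
    then obtain ws where ws: "card_of (Base K) = Is_finite ws" "set ws \<subseteq> words (X FactorA)"
      "el FactorA ` set ws = emb FactorA ` sub_val K"
      using card_of_sub(1)[OF assms] by auto
    have "foldr (\<lambda>w b. nontrivial_word w \<or> b) ws False \<longleftrightarrow> (\<exists>w \<in> set ws. nontrivial_word w)" for ws
      by (induction ws) auto
    then have "nontrivial_sub K \<longleftrightarrow> (\<exists>w \<in> set ws. el FactorA w \<noteq> \<one>\<^bsub>F FactorA\<^esub>)"
      using ws(2) nontrivial_word False unfolding nontrivial_sub_def ws(1) by (simp add: subset_iff)
    also have "\<dots> \<longleftrightarrow> (\<exists>a \<in> emb FactorA ` sub_val K. a \<noteq> \<one>\<^bsub>F FactorA\<^esub>)"
      unfolding ws(3)[symmetric] by blast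
    also have "\<dots> \<longleftrightarrow> (\<exists>c \<in> sub_val K. c \<noteq> \<one>\<^bsub>C\<^esub>)"
      using subgroup.mem_carrier[OF sub] emb_eq_iff[OF _ C.one_closed, of _ FactorA] by auto
    also have "\<dots> \<longleftrightarrow> sub_val K \<noteq> {\<one>\<^bsub>C\<^esub>}"
      using subgroup.one_closed[OF sub] by auto
    finally show ?thesis .
  qed
qed

lemma singular_iff:
  assumes "w \<in> words GX"
  shows "singular (normalize w) \<longleftrightarrow> gel w \<in> black_hole G CG"
proof -
  obtain v ss where n: "normalize w = (v, ss)" by (cases "normalize w")
  have vs: "v \<in> words {..<length zs}" "ss \<in> lists syl_words" "reduced (els ss)"
    and g: "gel w = prod_syllables (els ss) \<otimes>\<^bsub>G\<^esub> inc_C (ev v)"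
    using normalize[OF assms] by (auto simp: n good_def val_def)
  have ex: "(\<exists>H. P H) \<longleftrightarrow> P FactorA \<or> P FactorB" for P by (metis factor.exhaust)
  show ?thesis
    unfolding g black_hole_iff[OF vs(3) ev_closed[OF vs(1)]] ex
    using vs nontrivial_sub core_expr[OF vs(2)] subst_word[OF vs(1)]
    by (cases ss) (auto simp: n singular_def in_Z els_def)
qed

end

section \<open>Computability of the decision procedure\<close>

abbreviation "enc_gword \<equiv> enc_list enc_letter"
abbreviation "enc_syllable \<equiv> enc_pair enc_factor enc_gword"
abbreviation "enc_nform \<equiv> enc_pair enc_gword (enc_list enc_syllable)"

section \<open>Factors, words and expressions as coded data\<close>

lemma inj_enc_factor: "inj enc_factor"
proof (rule injI)
  show "enc_factor H = enc_factor K \<Longrightarrow> H = K" for H K by (cases H; cases K) auto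
qed

lemma finite_factor: "finite (A :: factor set)"
proof (rule finite_subset)
  show "A \<subseteq> {FactorA, FactorB}" using factor.exhaust by blast
qed simp

lemma computable_factor_eq:
  assumes "computable ei enc_factor I f" "computable ei enc_factor I g"
  shows "computable ei enc_bool I (\<lambda>x. f x = g x)"
proof -
  have "computable (enc_pair enc_factor enc_factor) enc_bool (UNIV \<times> UNIV) (\<lambda>p. fst p = snd p)"
    by (intro computable_finite finite_cartesian_product finite_factor
        inj_on_subset[OF inj_enc_pair[OF inj_enc_factor inj_enc_factor]]) simp
  from computable_comp[OF this computable_Pair[OF assms]] show ?thesis by simp
qed

text \<open>There is a separate algorithm for each factor, so the tag is inspected before one of
  them is called.\<close>

lemma computable_case_factor:
  assumes "computable ei enc_factor I h" "\<And>H. computable ei eo {x \<in> I. h x = H} (f H)"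
  shows "computable ei eo I (\<lambda>x. f (h x) x)"
proof (rule computable_cong[OF computable_if[OF computable_factor_eq[OF assms(1) computable_const[of _ _ _ FactorA]]
      assms(2)[of FactorA]]])
  have "H \<noteq> FactorA \<longleftrightarrow> H = FactorB" for H by (cases H) auto
  then have "{x \<in> I. h x \<noteq> FactorA} = {x \<in> I. h x = FactorB}" by simp
  then show "computable ei eo {x \<in> I. h x \<noteq> FactorA} (f FactorB)"
    using assms(2)[of FactorB] by simp
  show "f (h x) x = (if h x = FactorA then f FactorA x else f FactorB x)" for x
    by (cases "h x") auto
qed

lemma computable_winv:
  assumes "computable ei enc_gword I f"
  shows "computable ei enc_gword I (\<lambda>x. winv (f x))"
proof -
  have eq: "winv w = foldl (\<lambda>u l. (fst l, \<not> snd l) # u) [] w" for w :: "nat gword"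
  proof -
    have "foldl (\<lambda>u l. (fst l, \<not> snd l) # u) v w = winv w @ v" for v
      by (induction w arbitrary: v) (auto simp: winv_def split_def)
    then show ?thesis by simp
  qed
  have "computable (enc_pair enc_gword enc_letter) enc_gword (UNIV \<times> UNIV) (\<lambda>(u, l). (fst l, \<not> snd l) # u)"
    unfolding split_def
    by (intro computable_Cons computable_Pair computable_not computable_fst
        computable_fst'[OF computable_snd] computable_snd'[OF computable_snd])
  from computable_foldl[OF this _ computable_const[of ei _ _ "[]"] _ assms]
  show ?thesis unfolding eq by simp
qed

text \<open>The bound \<open>n\<close> leaves finitely many letters, whose substituted words form a
  finite table; the rest is concatenation.\<close>

lemma computable_subst_word:
  assumes "computable ei enc_gword I f" "\<And>x. x \<in> I \<Longrightarrow> f x \<in> words {..<n}"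
  shows "computable ei enc_gword I (\<lambda>x. subst_word us (f x))"
proof -
  let ?g = "\<lambda>l. if snd l then us ! fst l else winv (us ! fst l)"
  have eq: "subst_word us w = foldr (\<lambda>l u. ?g l @ u) w []" for w
    by (induction w) (auto simp: subst_word_def split_def)
  let ?T = "{..<n} \<times> (UNIV :: bool set)"
  have "inj enc_letter" by (intro inj_enc_pair inj_on_id enc_bool_inj)
  then have g: "computable enc_letter enc_gword ?T ?g"
    by (intro computable_finite) (auto intro: inj_on_subset)
  have "computable (enc_pair enc_letter enc_gword) enc_gword (?T \<times> UNIV) (\<lambda>p. ?g (fst p) @ snd p)"
    by (intro computable_append computable_snd computable_comp[OF g computable_fst]) auto
  then have "computable (enc_pair enc_letter enc_gword) enc_gword (?T \<times> UNIV) (\<lambda>(l, u). ?g l @ u)"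
    by (simp add: split_def)
  from computable_foldr[OF this _ computable_const[of ei _ _ "[]"] _ assms(1)] assms(2)
  show ?thesis unfolding eq by (simp add: words_def)
qed

lemma computable_glue:
  assumes s: "computable ei enc_syllable I s" and ss: "computable ei (enc_list enc_syllable) I ss"
  shows "computable ei enc_nform I (\<lambda>x. glue (s x) (ss x))"
proof -
  have s': "computable ei enc_syllable J s" and ss': "computable ei (enc_list enc_syllable) J ss"
    if "J \<subseteq> I" for J
    using assms that by (auto intro: computable_mono)
  show ?thesis
    unfolding glue_def
    by (intro computable_if computable_Pair computable_append
        computable_is_Nil[OF ss] computable_factor_eq computable_fst'[OF s'] computable_snd'[OF s']
        computable_fst'[OF computable_hd_tl(1)[OF ss']] computable_snd'[OF computable_hd_tl(1)[OF ss']]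
        computable_hd_tl(2)[OF ss'] ss') auto
qed

text \<open>The code of an expression is a constant tag paired with the code of the arguments, so
  every constructor is an instance.\<close>

lemma computable_tagged:
  assumes "computable ei e I f" "\<And>x. eo (g x) = prod_encode (k, e (f x))"
  shows "computable ei eo I g"
proof (rule computable_recode, rule computable_cong)
  show "computable ei id I (\<lambda>x. enc_pair id e (k, f x))"
    by (intro computable_code computable_Pair computable_const assms)
qed (simp add: assms(2) enc_pair_def)

lemma computable_Base:
  "computable ei enc_sub_expr I K \<Longrightarrow> computable ei enc_set_expr I (\<lambda>x. Base (K x))"
  by (erule computable_tagged) simp

lemma computable_Shift:
  assumes "computable ei enc_gword I u" "computable ei enc_set_expr I D" "computable ei enc_gword I v"
  shows "computable ei enc_set_expr I (\<lambda>x. Shift (u x) (D x) (v x))"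
  by (rule computable_tagged[OF computable_Pair[OF assms(1) computable_Pair[OF assms(2,3)]]])
    (simp add: enc_pair_def enc_word_eq)

lemma computable_Inter:
  assumes "computable ei enc_set_expr I D" "computable ei enc_set_expr I E"
  shows "computable ei enc_set_expr I (\<lambda>x. Inter (D x) (E x))"
  by (rule computable_tagged[OF computable_Pair[OF assms]]) (simp add: enc_pair_def)

lemma computable_Translate:
  assumes "computable ei enc_factor I H" "computable ei enc_set_expr I D" "computable ei enc_gword I h"
  shows "computable ei enc_sub_expr I (\<lambda>x. Translate (H x) (D x) (h x))"
  by (rule computable_tagged[OF computable_Pair[OF assms(1) computable_Pair[OF assms(2,3)]]])
    (simp add: enc_pair_def enc_word_eq)

section \<open>The procedure as an algorithm relative to the given ones\<close>

locale amalgam_algorithms = amalgam_oracles X R C zs emb us mem card_of in_Z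
  for X R and C :: "'c monoid" and zs emb us mem card_of in_Z +
  assumes mem_computable: "computable enc_gword (enc_option enc_gword) (words (X H)) (mem H)"
    and card_of_computable:
      "computable enc_set_expr enc_card_answer {D. set_ok D FactorA} card_of"
    and in_Z_computable: "computable enc_gword enc_bool (words (X H)) (in_Z H)"
begin

lemma computable_push:
  "computable (enc_pair enc_syllable enc_nform) enc_nform (syl_words \<times> good) (\<lambda>(s, st). push s st)"
proof -
  let ?e = "enc_pair enc_syllable enc_nform" and ?I = "syl_words \<times> good"
  let ?g = "\<lambda>x. glue (fst x) (snd (snd x))"
  let ?m = "\<lambda>x. mem (fst (fst x)) (fst (?g x))"
  have H: "computable ?e enc_factor J (\<lambda>x. fst (fst x))" for J
    by (rule computable_fst'[OF computable_fst])
  have v: "computable ?e enc_gword J (\<lambda>x. fst (snd x))" for J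
    by (rule computable_fst'[OF computable_snd])
  have g: "computable ?e enc_nform J ?g" for J
    by (intro computable_glue computable_fst computable_snd'[OF computable_snd])
  \<comment> \<open>The membership algorithm is reliable only on words of its own factor, so every
    query has to be such a word; the invariant \<open>good\<close> ensures this.\<close>
  note g1 = computable_fst'[OF g] and g2 = computable_snd'[OF g]
  have words_g: "fst (?g x) \<in> words (X (fst (fst x)))" "(fst (snd x), snd (?g x)) \<in> good" if "x \<in> ?I" for x
    using that glue[of "fst (snd x)" "snd (snd x)" "snd (fst x)" "fst (fst x)" "fst (?g x)" "snd (?g x)"]
    by (auto simp: syl_words_def)
  have m: "computable ?e (enc_option enc_gword) J ?m" if "J \<subseteq> ?I" for J
  proof (rule computable_case_factor[OF H])
    show "computable ?e (enc_option enc_gword) {x \<in> J. fst (fst x) = H} (\<lambda>x. mem H (fst (?g x)))" for H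
      by (rule computable_comp[OF mem_computable g1]) (use words_g that in auto)
  qed
  have the_m: "computable ?e enc_gword J (\<lambda>x. the (?m x))" if "J \<subseteq> ?I \<inter> {x. ?m x \<noteq> None}" for J
    by (rule computable_the[OF m]) (use that in auto)
  \<comment> \<open>The inputs of the last branch: the element lies in C and a syllable is left to
    absorb it. Only here are \<open>the\<close> and \<open>hd\<close> both meaningful.\<close>
  let ?J = "{x \<in> {x \<in> ?I. ?m x \<noteq> None}. snd (?g x) \<noteq> []}"
  have hd: "computable ?e enc_syllable J (\<lambda>x. hd (snd (?g x)))" if "J \<subseteq> ?J" for J
    by (rule computable_hd_tl[OF g2]) (use that in auto)
  have subst: "computable ?e enc_gword ?J (\<lambda>x. subst_word (us (fst (hd (snd (?g x))))) (the (?m x)))"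
  proof (rule computable_case_factor[OF computable_fst'[OF hd]])
    show "computable ?e enc_gword {x \<in> ?J. fst (hd (snd (?g x))) = K} (\<lambda>x. subst_word (us K) (the (?m x)))" for K
    proof (rule computable_subst_word[OF the_m])
      show "the (?m x) \<in> words {..<length zs}" if "x \<in> {x \<in> ?J. fst (hd (snd (?g x))) = K}" for x
      proof -
        have x: "x \<in> ?I" "?m x \<noteq> None" using that by blast+
        then obtain v where "?m x = Some v" by blast
        from mem_Some(1)[OF words_g(1)[OF x(1)] this] show ?thesis by (simp add: \<open>?m x = Some v\<close>)
      qed
    qed auto
  qed simp
  have "computable ?e enc_nform ?I (\<lambda>x. push (fst x) (snd x))"
    unfolding push_def
  proof (intro computable_if computable_Pair)
    show "computable ?e enc_bool ?I (\<lambda>x. ?m x = None)"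
      by (rule computable_is_None[OF m]) simp
    show "computable ?e enc_bool {x \<in> ?I. ?m x \<noteq> None} (\<lambda>x. snd (?g x) = [])"
      by (rule computable_is_Nil[OF g2])
  qed (intro H v computable_Cons computable_Pair g1 g2 computable_append computable_const
       the_m subst computable_fst'[OF hd] computable_snd'[OF hd] computable_hd_tl(2)[OF g2]; auto)+
  then show ?thesis by (simp add: split_def)
qed

text \<open>A finite table reads the letters of G, and \<open>good\<close> is the invariant of the
  fold that keeps \<open>push\<close> inside its domain.\<close>

lemma computable_normalize:
  "computable (enc_word sum_encode) enc_nform (words GX) normalize"
proof -
  let ?T = "GX \<times> (UNIV :: bool set)"
  have "inj (enc_pair sum_encode enc_bool)" by (intro inj_enc_pair inj_sum_encode enc_bool_inj)
  moreover have "finite GX" using finite_X by (simp add: amalg_gens_def)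
  ultimately have letter: "computable (enc_pair sum_encode enc_bool) enc_syllable ?T syllable"
    by (intro computable_finite) (auto intro: inj_on_subset)
  have s: "computable (enc_pair (enc_pair sum_encode enc_bool) enc_nform) enc_syllable (?T \<times> good)
      (\<lambda>p. syllable (fst p))"
    by (rule computable_comp[OF letter computable_fst]) auto
  have syl: "syllable l \<in> syl_words" if "l \<in> ?T" for l
    using letter_cases[of l] that by (force simp: syllable_side syl_words_def)
  from computable_comp[OF computable_push computable_Pair[OF s computable_snd]]
  have step: "computable (enc_pair (enc_pair sum_encode enc_bool) enc_nform) enc_nform (?T \<times> good)
      (\<lambda>(l, st). push (syllable l) st)"
    using syl by (auto simp: split_def)
  have closed: "push (syllable l) st \<in> good" if "st \<in> good" "l \<in> ?T" for l st
    using syl[OF that(2)] push(1)[OF that(1)] by (cases "syllable l") (auto simp: syl_words_def)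
  have "([], []) \<in> good" by (simp add: good_def)
  from computable_foldr[OF step closed computable_const[of _ _ _ "([], [])"] this computable_id]
  show ?thesis unfolding normalize_def enc_word_eq by (simp add: words_def)
qed

lemma computable_core_expr:
  assumes "computable ei (enc_list enc_syllable) I f"
  shows "computable ei enc_sub_expr I (\<lambda>x. core_expr (f x))"
proof -
  have "computable (enc_pair enc_syllable enc_sub_expr) enc_sub_expr (UNIV \<times> UNIV) (\<lambda>(s, K). core_step s K)"
    unfolding core_step_def split_def
    by (intro computable_Translate computable_Inter computable_Shift computable_Base computable_winv
        computable_fst'[OF computable_fst] computable_snd'[OF computable_fst] computable_snd computable_const)
  from computable_foldr[OF this _ computable_const[of _ _ _ top_expr] _ assms]
  show ?thesis by (simp add: core_expr_def)
qed

lemma computable_listing: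
  assumes "computable ei enc_card_answer I f" "\<And>x. x \<in> I \<Longrightarrow> \<exists>ws. f x = Is_finite ws"
  shows "computable ei (enc_list enc_gword) I (\<lambda>x. listing (f x))"
\<comment> \<open>The codes 0 and 1 belong to the other two answers, so lists are shifted by 2 and
  two predecessors recover them.\<close>
proof (rule computable_recode, rule computable_cong[OF computable_pred[OF computable_pred[OF computable_code[OF assms(1)]]]])
  show "enc_list enc_gword (listing (f x)) = enc_card_answer (f x) - 1 - 1" if "x \<in> I" for x
    using assms(2)[OF that] by (auto simp: enc_card_answer_def enc_word_eq enc_list_def)
qed

lemma computable_nontrivial_word:
  "computable enc_gword enc_bool (words (X FactorA)) nontrivial_word"
proof -
  have "computable enc_gword enc_set_expr (words (X FactorA)) word_expr"
    unfolding word_expr_def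
    by (intro computable_Inter computable_Shift computable_id computable_const)
  from computable_comp[OF card_of_computable this] word_expr(1)
  have c: "computable enc_gword enc_card_answer (words (X FactorA)) (\<lambda>w. card_of (word_expr w))" by auto
  show ?thesis
    unfolding nontrivial_word_def
    by (rule computable_cong[OF computable_eq_0[OF computable_code[OF c]]])
      (auto simp: enc_card_answer_def split: card_answer.splits)
qed

lemma computable_nontrivial_sub:
  "computable enc_sub_expr enc_bool {K. sub_ok K} nontrivial_sub"
proof -
  have c: "computable enc_sub_expr enc_card_answer J (\<lambda>K. card_of (Base K))" if "J \<subseteq> {K. sub_ok K}" for J
    by (rule computable_comp[OF card_of_computable computable_Base[OF computable_id]]) (use that in auto)
  have step: "computable (enc_pair enc_gword enc_bool) enc_bool (words (X FactorA) \<times> UNIV)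
      (\<lambda>(w, b). nontrivial_word w \<or> b)"
    unfolding split_def
    by (intro computable_or computable_snd computable_comp[OF computable_nontrivial_word computable_fst]) auto
  have inf: "computable enc_sub_expr enc_bool {K. sub_ok K} (\<lambda>K. card_of (Base K) = Is_infinite)"
    \<comment> \<open>The code of \<open>Is_infinite\<close> is 1.\<close>
    by (rule computable_cong[OF computable_eq_const[OF computable_code[OF c], where k = 1]])
      (auto simp: enc_card_answer_def split: card_answer.splits)
  let ?J = "{K \<in> {K. sub_ok K}. card_of (Base K) \<noteq> Is_infinite}"
  have fin: "\<exists>ws. card_of (Base K) = Is_finite ws \<and> set ws \<subseteq> words (X FactorA)" if "K \<in> ?J" for K
    using card_of_sub(1)[of K] that by auto
  have "computable enc_sub_expr (enc_list enc_gword) ?J (\<lambda>K. listing (card_of (Base K)))"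
    by (rule computable_listing[OF c]) (use fin in auto)
  from computable_foldr[OF step _ computable_const[of _ _ _ False] _ this] fin
  have "computable enc_sub_expr enc_bool ?J
      (\<lambda>K. foldr (\<lambda>w b. nontrivial_word w \<or> b) (listing (card_of (Base K))) False)"
    by fastforce
  then show ?thesis
    unfolding nontrivial_sub_def by (intro computable_if computable_const inf)
qed

lemma computable_singular: "computable enc_nform enc_bool good singular"
proof -
  have Z: "computable enc_nform enc_bool {st \<in> good. snd st = []} (\<lambda>st. in_Z H (subst_word (us H) (fst st)))" for H
  proof (rule computable_comp[OF in_Z_computable computable_subst_word[OF computable_fst]])
    show "fst st \<in> words {..<length zs}" if "st \<in> {st \<in> good. snd st = []}" for st
      using that by (auto simp: good_def)
    then show "subst_word (us H) (fst st) \<in> words (X H)" if "st \<in> {st \<in> good. snd st = []}" for st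
      using subst_word that by blast
  qed
  have "sub_ok (core_expr (snd st))" if "st \<in> good" for st
    using core_expr[of "snd st"] that unfolding good_def by force
  note core_ok = this
  have N: "computable enc_nform enc_bool {st \<in> good. snd st \<noteq> []} (\<lambda>st. nontrivial_sub (core_expr (snd st)))"
    by (rule computable_comp[OF computable_nontrivial_sub computable_core_expr[OF computable_snd]])
      (use core_ok in auto)
  show ?thesis
    unfolding singular_def
    by (intro computable_if computable_is_Nil[OF computable_snd] computable_or Z N)
qed

lemma regular_decidable:
  "membership_problem sum_encode GX GR {g. regular G (inc FactorA ` emb FactorA ` carrier C) g}"
  unfolding membership_problem_def
proof (rule algorithmI)
  show "computable (enc_word sum_encode) enc_bool (words GX) (\<lambda>w. \<not> singular (normalize w))"
    by (intro computable_not computable_comp[OF computable_singular computable_normalize])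
      (use normalize in auto)
  have "inc FactorA ` emb FactorA ` carrier C = CG" by (simp add: image_image inc_C_def)
  then show "(\<not> singular (normalize w)) \<longleftrightarrow> gel w \<in> {g. regular G (inc FactorA ` emb FactorA ` carrier C) g}"
    if "w \<in> words GX" for w
    using singular_iff[OF that] that by (simp add: regular_def)
qed

end

theorem theorem4p1:
  fixes X Y :: "nat set" and RA RB :: "nat gword set"
    and C :: "'c monoid" and zs :: "'c list"
    and \<phi> \<psi> :: "'c \<Rightarrow> nat gword set"
    and us vs :: "nat gword list"
  assumes "finite_presentation X RA" and "finite_presentation Y RB"
    and "group C" and "set zs \<subseteq> carrier C" and "carrier C = generate C (set zs)"
    and "\<phi> \<in> mon C (pres_group X RA)" and "\<psi> \<in> mon C (pres_group Y RB)"
    and "list_all2 (\<lambda>u z. u \<in> words X \<and> cls X RA u = \<phi> z) us zs"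
    and "list_all2 (\<lambda>v z. v \<in> words Y \<and> cls Y RB v = \<psi> z) vs zs"
    and "membership_search_problem X RA us (\<phi> ` carrier C)"
    and "membership_search_problem Y RB vs (\<psi> ` carrier C)"
    and "coset_rep_search_problem X RA (\<phi> ` carrier C)"
    and "coset_rep_search_problem Y RB (\<psi> ` carrier C)"
    and "cardinality_search_problem
           (case_factor X Y) (case_factor RA RB) C zs (case_factor \<phi> \<psi>) FactorA"
    and "cardinality_search_problem
           (case_factor X Y) (case_factor RA RB) C zs (case_factor \<phi> \<psi>) FactorB"
    and "membership_problem id X RA (Nstar (pres_group X RA) (\<phi> ` carrier C))"
    and "membership_problem id X RA (Zset (pres_group X RA) (\<phi> ` carrier C))"
    and "membership_problem id Y RB (Nstar (pres_group Y RB) (\<psi> ` carrier C))"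
    and "membership_problem id Y RB (Zset (pres_group Y RB) (\<psi> ` carrier C))"
  shows "membership_problem sum_encode (amalg_gens X Y) (amalg_rels RA RB us vs)
           {g. regular (pres_group (amalg_gens X Y) (amalg_rels RA RB us vs))
                 (induced_map (amalg_gens X Y) (amalg_rels RA RB us vs) Inl ` \<phi> ` carrier C) g}"
proof -
  let ?X = "case_factor X Y" and ?R = "case_factor RA RB" and ?emb = "case_factor \<phi> \<psi>"
    and ?us = "case_factor us vs"
  interpret presented_amalgam ?X ?R C zs ?emb ?us
  proof (rule presented_amalgam.intro)
    show "group C" "set zs \<subseteq> carrier C" "carrier C = generate C (set zs)" by fact+
    show "finite_presentation (?X H) (?R H)" for H using assms(1,2) by (cases H) auto
    show "?emb H \<in> mon C (pres_group (?X H) (?R H))" for H using assms(6,7) by (cases H) auto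
    show "list_all2 (\<lambda>u z. u \<in> words (?X H) \<and> cls (?X H) (?R H) u = ?emb H z) (?us H) zs" for H
      using assms(8,9) by (cases H) auto
  qed
  have "\<forall>H. \<exists>f. computable enc_gword (enc_option enc_gword) (words (?X H)) f \<and>
      (\<forall>w \<in> words (?X H). case f w of None \<Rightarrow> el H w \<notin> im H
     | Some v \<Rightarrow> el H w \<in> im H \<and> v \<in> words {..<length zs} \<and> el H (subst_word (?us H) v) = el H w)"
  proof
    fix H
    have "membership_search_problem (?X H) (?R H) (?us H) (im H)"
      using assms(10,11) by (cases H) auto
    then show "\<exists>f. computable enc_gword (enc_option enc_gword) (words (?X H)) f \<and>
      (\<forall>w \<in> words (?X H). case f w of None \<Rightarrow> el H w \<notin> im H
     | Some v \<Rightarrow> el H w \<in> im H \<and> v \<in> words {..<length zs} \<and> el H (subst_word (?us H) v) = el H w)"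
      unfolding membership_search_problem_def enc_word_eq length_us
      by (rule algorithm_choice) blast
  qed
  from choice[OF this] obtain mem where
    mem_alg: "\<And>H. computable enc_gword (enc_option enc_gword) (words (?X H)) (mem H)"
    "\<And>H w. w \<in> words (?X H) \<Longrightarrow> (case mem H w of None \<Rightarrow> el H w \<notin> im H
     | Some v \<Rightarrow> el H w \<in> im H \<and> v \<in> words {..<length zs} \<and> el H (subst_word (?us H) v) = el H w)"
    by blast
  interpret amalgam_membership ?X ?R C zs ?emb ?us mem
    by unfold_locales (rule mem_alg(2))
  have "\<forall>H. \<exists>f. computable enc_gword enc_bool (words (?X H)) f \<and>
      (\<forall>w \<in> words (?X H). f w \<longleftrightarrow> el H w \<in> Zset (F H) (im H))"
  proof
    fix H
    have "membership_problem id (?X H) (?R H) (Zset (F H) (im H))"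
      using assms(17,19) by (cases H) auto
    then show "\<exists>f. computable enc_gword enc_bool (words (?X H)) f \<and>
      (\<forall>w \<in> words (?X H). f w \<longleftrightarrow> el H w \<in> Zset (F H) (im H))"
      unfolding membership_problem_def enc_word_eq by (rule algorithm_choice) blast
  qed
  from choice[OF this] obtain in_Z where
    in_Z: "\<And>H. computable enc_gword enc_bool (words (?X H)) (in_Z H)"
    "\<And>H w. w \<in> words (?X H) \<Longrightarrow> in_Z H w \<longleftrightarrow> el H w \<in> Zset (F H) (im H)"
    by blast
  \<comment> \<open>By \<open>valid_in_Phi\<close> the Cardinality Search accepts every valid
    expression as input.\<close>
  have "{D. set_ok D FactorA \<and> set_val D FactorA \<in> Phi (Sub (F FactorA) (im FactorA)) (F FactorA)}
      = {D. set_ok D FactorA}"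
    using valid_in_Phi by blast
  with assms(14) obtain card_of where card_of:
    "computable enc_set_expr enc_card_answer {D. set_ok D FactorA} card_of"
    "\<And>D. set_ok D FactorA \<Longrightarrow>
      correct_card_answer (?X FactorA) (?R FactorA) (set_val D FactorA) (card_of D)"
    unfolding cardinality_search_problem_def by (auto elim: algorithm_choice)
  interpret amalgam_algorithms ?X ?R C zs ?emb ?us mem card_of in_Z
    by unfold_locales (fact mem_alg(1) in_Z card_of)+
  show ?thesis using regular_decidable by (simp add: side.simps)
qed

end
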